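(* Let $M$ and $N$ be objects of an abelian category $\mathcal{A}$. The following hold both with all words in parentheses omitted and with all of them included. (1) Assume that $\mathcal{A}$ is AB3*. Then $N$ is (strongly) $M$-CS-Baer and $N$ is $M$-$\mathcal{K}$-nonsingular if and only if $N$ is (strongly) $M$-Baer. (2) Assume that $\mathcal{A}$ is AB3. Then $N$ is dual (strongly) $M$-CS-Baer and $M$ is $N$-$\mathcal{T}$-nonsingular if and only if $N$ is dual (strongly) $M$-Baer.
   Context: An abelian category is AB3 (AB3* ) if it has arbitrary coproducts (products); it then has arbitrary sums (intersections) of families of subobjects. A subobject $i:K\to M$ is fully invariant if for every $h:M\to M$ one has $hi=i\alpha$ for some $\alpha:K\to K$. A subobject $L$ of $N$ lies above a direct summand $K$ of $N$ if $K\subseteq L$ and $L/K$ is superfluous in $N/K$ (a subobject $A$ of $B$ is superfluous if $A+X=B$ implies $X=B$ for every subobject $X$ of $B$). In an AB3* abelian category: $N$ is (strongly) $M$-CS-Baer if for every family $(f_i)_{i\in I}$ of morphisms $f_i:M\to N$, $\bigcap_{i\in I}\mathrm{Ker}(f_i)$ is essential in a (fully invariant) direct summand of $M$; $N$ is (strongly) $M$-Baer if for every such family $\bigcap_{i\in I}\mathrm{Ker}(f_i)$ is a (fully invariant) direct summand of $M$. In an AB3 abelian category: $N$ is dual (strongly) $M$-CS-Baer if for every family $(f_i)_{i\in I}$ of morphisms $f_i:M\to N$, $\sum_{i\in I}\mathrm{Im}(f_i)$ lies above a (fully invariant) direct summand of $N$; $N$ is dual (strongly) $M$-Baer if for every such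 family $\sum_{i\in I}\mathrm{Im}(f_i)$ is a (fully invariant) direct summand of $N$. $N$ is $M$-$\mathcal{K}$-nonsingular if for any morphism $f:M\to N$, $\mathrm{Ker}(f)$ essential in $M$ implies $f=0$. $M$ is $N$-$\mathcal{T}$-nonsingular if for any morphism $f:M\to N$, $\mathrm{Im}(f)$ superfluous in $N$ implies $f=0$. *)

theory Defs
  imports "HOL-Algebra.Group"
begin

section \<open>Abelian categories\<close>

record ('o, 'm) cat =
  Obj :: "'o set"
  Arr :: "'m set"
  Dom :: "'m \<Rightarrow> 'o"
  Cod :: "'m \<Rightarrow> 'o"
  Ident :: "'o \<Rightarrow> 'm"
  Comp :: "'m \<Rightarrow> 'm \<Rightarrow> 'm"  (infixr "\<cdot>\<index>" 75)

text \<open>Composition is written in the order of functions: \<open>g \<cdot>\<^bsub>C\<^esub> f\<close> is \<open>g\<close> after \<open>f\<close>.\<close>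

record ('o, 'm) abcat = "('o, 'm) cat" +
  Add :: "'m \<Rightarrow> 'm \<Rightarrow> 'm"  (infixl "\<oplus>\<^sub>h\<index>" 65)
  Zero :: "'o \<Rightarrow> 'o \<Rightarrow> 'm"

definition Hom :: "('o, 'm, 'r) cat_scheme \<Rightarrow> 'o \<Rightarrow> 'o \<Rightarrow> 'm set" where
  "Hom C A B = {f \<in> Arr C. Dom C f = A \<and> Cod C f = B}"

locale category =
  fixes C :: "('o, 'm, 'r) cat_scheme" (structure)
  assumes Dom_Obj: "f \<in> Arr C \<Longrightarrow> Dom C f \<in> Obj C"
    and Cod_Obj: "f \<in> Arr C \<Longrightarrow> Cod C f \<in> Obj C"
    and Ident_Hom: "A \<in> Obj C \<Longrightarrow> Ident C A \<in> Hom C A A"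
    and Comp_Hom: "\<lbrakk>f \<in> Hom C A B; g \<in> Hom C B D\<rbrakk> \<Longrightarrow> g \<cdot> f \<in> Hom C A D"
    and Comp_Ident: "f \<in> Hom C A B \<Longrightarrow> f \<cdot> Ident C A = f"
    and Ident_Comp: "f \<in> Hom C A B \<Longrightarrow> Ident C B \<cdot> f = f"
    and Comp_assoc: "\<lbrakk>f \<in> Hom C A B; g \<in> Hom C B D; h \<in> Hom C D E\<rbrakk>
      \<Longrightarrow> (h \<cdot> g) \<cdot> f = h \<cdot> (g \<cdot> f)"

definition is_mono :: "('o, 'm, 'r) cat_scheme \<Rightarrow> 'm \<Rightarrow> bool" where
  "is_mono C m \<longleftrightarrow> m \<in> Arr C \<and>
    (\<forall>T. \<forall>x \<in> Hom C T (Dom C m). \<forall>y \<in> Hom C T (Dom C m).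
      m \<cdot>\<^bsub>C\<^esub> x = m \<cdot>\<^bsub>C\<^esub> y \<longrightarrow> x = y)"

definition is_epi :: "('o, 'm, 'r) cat_scheme \<Rightarrow> 'm \<Rightarrow> bool" where
  "is_epi C e \<longleftrightarrow> e \<in> Arr C \<and>
    (\<forall>T. \<forall>x \<in> Hom C (Cod C e) T. \<forall>y \<in> Hom C (Cod C e) T.
      x \<cdot>\<^bsub>C\<^esub> e = y \<cdot>\<^bsub>C\<^esub> e \<longrightarrow> x = y)"

definition is_zero_object :: "('o, 'm, 'r) cat_scheme \<Rightarrow> 'o \<Rightarrow> bool" where
  "is_zero_object C Z \<longleftrightarrow> Z \<in> Obj C \<and>
    (\<forall>A \<in> Obj C. (\<exists>!f. f \<in> Hom C A Z) \<and> (\<exists>!f. f \<in> Hom C Z A))"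

definition is_kernel :: "('o, 'm, 'r) abcat_scheme \<Rightarrow> 'm \<Rightarrow> 'm \<Rightarrow> bool" where
  "is_kernel C f k \<longleftrightarrow> f \<in> Arr C \<and> k \<in> Arr C \<and> Cod C k = Dom C f \<and>
    f \<cdot>\<^bsub>C\<^esub> k = Zero C (Dom C k) (Cod C f) \<and>
    (\<forall>T. \<forall>t \<in> Hom C T (Dom C f). f \<cdot>\<^bsub>C\<^esub> t = Zero C T (Cod C f) \<longrightarrow>
      (\<exists>!u. u \<in> Hom C T (Dom C k) \<and> k \<cdot>\<^bsub>C\<^esub> u = t))"

definition is_cokernel :: "('o, 'm, 'r) abcat_scheme \<Rightarrow> 'm \<Rightarrow> 'm \<Rightarrow> bool" where
  "is_cokernel C f q \<longleftrightarrow> f \<in> Arr C \<and> q \<in> Arr C \<and> Dom C q = Cod C f \<and>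
    q \<cdot>\<^bsub>C\<^esub> f = Zero C (Dom C f) (Cod C q) \<and>
    (\<forall>T. \<forall>t \<in> Hom C (Cod C f) T. t \<cdot>\<^bsub>C\<^esub> f = Zero C (Dom C f) T \<longrightarrow>
      (\<exists>!u. u \<in> Hom C (Cod C q) T \<and> u \<cdot>\<^bsub>C\<^esub> q = t))"

definition is_biproduct ::
  "('o, 'm, 'r) abcat_scheme \<Rightarrow> 'o \<Rightarrow> 'o \<Rightarrow> 'o \<Rightarrow> 'm \<Rightarrow> 'm \<Rightarrow> 'm \<Rightarrow> 'm \<Rightarrow> bool" where
  "is_biproduct C A B S i j p q \<longleftrightarrow> A \<in> Obj C \<and> B \<in> Obj C \<and> S \<in> Obj C \<and>
    i \<in> Hom C A S \<and> j \<in> Hom C B S \<and> p \<in> Hom C S A \<and> q \<in> Hom C S B \<and>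
    p \<cdot>\<^bsub>C\<^esub> i = Ident C A \<and> q \<cdot>\<^bsub>C\<^esub> j = Ident C B \<and>
    p \<cdot>\<^bsub>C\<^esub> j = Zero C B A \<and> q \<cdot>\<^bsub>C\<^esub> i = Zero C A B \<and>
    (i \<cdot>\<^bsub>C\<^esub> p) \<oplus>\<^sub>h\<^bsub>C\<^esub> (j \<cdot>\<^bsub>C\<^esub> q) = Ident C S"

locale abelian_category = category C for C :: "('o, 'm, 'r) abcat_scheme" (structure) +
  assumes Hom_group: "\<lbrakk>A \<in> Obj C; B \<in> Obj C\<rbrakk>
      \<Longrightarrow> comm_group \<lparr>carrier = Hom C A B, monoid.mult = Add C, one = Zero C A B\<rparr>"
    and Comp_Add_left: "\<lbrakk>f \<in> Hom C A B; g \<in> Hom C B D; h \<in> Hom C B D\<rbrakk>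
      \<Longrightarrow> (g \<oplus>\<^sub>h h) \<cdot> f = (g \<cdot> f) \<oplus>\<^sub>h (h \<cdot> f)"
    and Comp_Add_right: "\<lbrakk>f \<in> Hom C A B; g \<in> Hom C A B; h \<in> Hom C B D\<rbrakk>
      \<Longrightarrow> h \<cdot> (f \<oplus>\<^sub>h g) = (h \<cdot> f) \<oplus>\<^sub>h (h \<cdot> g)"
    and zero_object_ex: "\<exists>Z. is_zero_object C Z"
    and biproduct_ex: "\<lbrakk>A \<in> Obj C; B \<in> Obj C\<rbrakk> \<Longrightarrow> \<exists>S i j p q. is_biproduct C A B S i j p q"
    and kernel_ex: "f \<in> Arr C \<Longrightarrow> \<exists>k. is_kernel C f k"
    and cokernel_ex: "f \<in> Arr C \<Longrightarrow> \<exists>q. is_cokernel C f q"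
    and mono_is_kernel: "is_mono C m \<Longrightarrow> \<exists>f. is_kernel C f m"
    and epi_is_cokernel: "is_epi C e \<Longrightarrow> \<exists>f. is_cokernel C f e"

definition is_product ::
  "('o, 'm, 'r) cat_scheme \<Rightarrow> 'i set \<Rightarrow> ('i \<Rightarrow> 'o) \<Rightarrow> 'o \<Rightarrow> ('i \<Rightarrow> 'm) \<Rightarrow> bool" where
  "is_product C I A P \<pi> \<longleftrightarrow> P \<in> Obj C \<and> (\<forall>i\<in>I. \<pi> i \<in> Hom C P (A i)) \<and>
    (\<forall>T \<in> Obj C. \<forall>t. (\<forall>i\<in>I. t i \<in> Hom C T (A i)) \<longrightarrow>
      (\<exists>!u. u \<in> Hom C T P \<and> (\<forall>i\<in>I. \<pi> i \<cdot>\<^bsub>C\<^esub> u = t i)))"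

definition is_coproduct ::
  "('o, 'm, 'r) cat_scheme \<Rightarrow> 'i set \<Rightarrow> ('i \<Rightarrow> 'o) \<Rightarrow> 'o \<Rightarrow> ('i \<Rightarrow> 'm) \<Rightarrow> bool" where
  "is_coproduct C I A S \<iota> \<longleftrightarrow> S \<in> Obj C \<and> (\<forall>i\<in>I. \<iota> i \<in> Hom C (A i) S) \<and>
    (\<forall>T \<in> Obj C. \<forall>t. (\<forall>i\<in>I. t i \<in> Hom C (A i) T) \<longrightarrow>
      (\<exists>!u. u \<in> Hom C S T \<and> (\<forall>i\<in>I. u \<cdot>\<^bsub>C\<^esub> \<iota> i = t i)))"

text \<open>
  HOL cannot quantify over all types inside a formula, so ``arbitrary index sets'' are all
  sets over an index type \<open>'i\<close>, made explicit by an argument \<open>TYPE('i)\<close>. A theorem in which \<open>'i\<close>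
  is a free type variable holds for every index type.  The same \<open>'i\<close> indexes the families of
  morphisms in the Baer-type conditions below.
\<close>

definition AB3_star :: "('o, 'm, 'r) cat_scheme \<Rightarrow> 'i itself \<Rightarrow> bool" where
  "AB3_star C (_ :: 'i itself) \<longleftrightarrow>
    (\<forall>(I :: 'i set) A. (\<forall>i\<in>I. A i \<in> Obj C) \<longrightarrow> (\<exists>P \<pi>. is_product C I A P \<pi>))"

definition AB3 :: "('o, 'm, 'r) cat_scheme \<Rightarrow> 'i itself \<Rightarrow> bool" where
  "AB3 C (_ :: 'i itself) \<longleftrightarrow>
    (\<forall>(I :: 'i set) A. (\<forall>i\<in>I. A i \<in> Obj C) \<longrightarrow> (\<exists>S \<iota>. is_coproduct C I A S \<iota>))"


section \<open>Subobjects\<close>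

text \<open>
  A subobject of \<open>M\<close> is represented by a monomorphism into \<open>M\<close>; two of them represent the same
  subobject when each factors through the other.  \<open>Kern\<close>, \<open>Cokern\<close>, \<open>Img\<close>, \<open>SubInter\<close> and \<open>SubSum\<close> choose
  representatives; all properties considered below are independent of the choice.
\<close>

definition subobj :: "('o, 'm, 'r) cat_scheme \<Rightarrow> 'o \<Rightarrow> 'm \<Rightarrow> bool" where
  "subobj C M m \<longleftrightarrow> is_mono C m \<and> Cod C m = M"

definition sub_le :: "('o, 'm, 'r) cat_scheme \<Rightarrow> 'm \<Rightarrow> 'm \<Rightarrow> bool" where
  "sub_le C m n \<longleftrightarrow> (\<exists>u \<in> Hom C (Dom C m) (Dom C n). n \<cdot>\<^bsub>C\<^esub> u = m)"

definition sub_eq :: "('o, 'm, 'r) cat_scheme \<Rightarrow> 'm \<Rightarrow> 'm \<Rightarrow> bool" where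
  "sub_eq C m n \<longleftrightarrow> sub_le C m n \<and> sub_le C n m"

definition Kern :: "('o, 'm, 'r) abcat_scheme \<Rightarrow> 'm \<Rightarrow> 'm" where
  "Kern C f = (SOME k. is_kernel C f k)"

definition Cokern :: "('o, 'm, 'r) abcat_scheme \<Rightarrow> 'm \<Rightarrow> 'm" where
  "Cokern C f = (SOME q. is_cokernel C f q)"

definition Img :: "('o, 'm, 'r) abcat_scheme \<Rightarrow> 'm \<Rightarrow> 'm" where
  "Img C f = Kern C (Cokern C f)"

text \<open>
  Intersections and sums are infima and suprema in the preorder of subobjects of \<open>M\<close>.  For
  the empty family they are \<open>M\<close> and \<open>0\<close>.
\<close>

definition is_inter :: "('o, 'm, 'r) cat_scheme \<Rightarrow> 'o \<Rightarrow> 'm set \<Rightarrow> 'm \<Rightarrow> bool" where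
  "is_inter C M S m \<longleftrightarrow> subobj C M m \<and> (\<forall>s\<in>S. sub_le C m s) \<and>
    (\<forall>n. subobj C M n \<and> (\<forall>s\<in>S. sub_le C n s) \<longrightarrow> sub_le C n m)"

definition is_sum :: "('o, 'm, 'r) cat_scheme \<Rightarrow> 'o \<Rightarrow> 'm set \<Rightarrow> 'm \<Rightarrow> bool" where
  "is_sum C M S m \<longleftrightarrow> subobj C M m \<and> (\<forall>s\<in>S. sub_le C s m) \<and>
    (\<forall>n. subobj C M n \<and> (\<forall>s\<in>S. sub_le C s n) \<longrightarrow> sub_le C m n)"

definition SubInter :: "('o, 'm, 'r) cat_scheme \<Rightarrow> 'o \<Rightarrow> 'm set \<Rightarrow> 'm" where
  "SubInter C M S = (SOME m. is_inter C M S m)"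

definition SubSum :: "('o, 'm, 'r) cat_scheme \<Rightarrow> 'o \<Rightarrow> 'm set \<Rightarrow> 'm" where
  "SubSum C M S = (SOME m. is_sum C M S m)"

definition fully_invariant :: "('o, 'm, 'r) cat_scheme \<Rightarrow> 'o \<Rightarrow> 'm \<Rightarrow> bool" where
  "fully_invariant C M i \<longleftrightarrow> subobj C M i \<and>
    (\<forall>h \<in> Hom C M M. \<exists>\<alpha> \<in> Hom C (Dom C i) (Dom C i). h \<cdot>\<^bsub>C\<^esub> i = i \<cdot>\<^bsub>C\<^esub> \<alpha>)"

definition direct_summand :: "('o, 'm, 'r) abcat_scheme \<Rightarrow> 'o \<Rightarrow> 'm \<Rightarrow> bool" where
  "direct_summand C M k \<longleftrightarrow> subobj C M k \<and>
    (\<exists>k' p p'. is_biproduct C (Dom C k) (Dom C k') M k k' p p')"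

definition essential :: "('o, 'm, 'r) cat_scheme \<Rightarrow> 'o \<Rightarrow> 'm \<Rightarrow> bool" where
  "essential C B a \<longleftrightarrow> subobj C B a \<and>
    (\<forall>x. subobj C B x \<and> is_zero_object C (Dom C (SubInter C B {a, x})) \<longrightarrow>
      is_zero_object C (Dom C x))"

definition superfluous :: "('o, 'm, 'r) cat_scheme \<Rightarrow> 'o \<Rightarrow> 'm \<Rightarrow> bool" where
  "superfluous C B a \<longleftrightarrow> subobj C B a \<and>
    (\<forall>x. subobj C B x \<and> sub_eq C (SubSum C B {a, x}) (Ident C B) \<longrightarrow> sub_eq C x (Ident C B))"

text \<open>For subobjects \<open>l\<close> and \<open>k\<close> of the same object: \<open>l\<close> is contained, and essential, in \<open>k\<close>.\<close>

definition essential_in :: "('o, 'm, 'r) cat_scheme \<Rightarrow> 'm \<Rightarrow> 'm \<Rightarrow> bool" where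
  "essential_in C l k \<longleftrightarrow>
    (\<exists>u \<in> Hom C (Dom C l) (Dom C k). k \<cdot>\<^bsub>C\<^esub> u = l \<and> essential C (Dom C k) u)"

text \<open>
  For subobjects \<open>k : K \<rightarrow> N\<close> and \<open>l : L \<rightarrow> N\<close>, with \<open>u : K \<rightarrow> L\<close> the inclusion, \<open>v\<close> is the
  induced morphism from \<open>L/K = Cokern u\<close> to \<open>N/K = Cokern k\<close>.
\<close>

definition lies_above :: "('o, 'm, 'r) abcat_scheme \<Rightarrow> 'm \<Rightarrow> 'm \<Rightarrow> bool" where
  "lies_above C l k \<longleftrightarrow>
    (\<exists>u \<in> Hom C (Dom C k) (Dom C l). l \<cdot>\<^bsub>C\<^esub> u = k \<and>
      (\<exists>v \<in> Hom C (Cod C (Cokern C u)) (Cod C (Cokern C k)).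
        v \<cdot>\<^bsub>C\<^esub> Cokern C u = Cokern C k \<cdot>\<^bsub>C\<^esub> l \<and>
        superfluous C (Cod C (Cokern C k)) v))"


section \<open>Baer-type and nonsingularity conditions\<close>

text \<open>
  Argument order: \<open>cs_baer C TYPE('i) M N\<close> reads ``\<open>N\<close> is \<open>M\<close>-CS-Baer'', and likewise for the
  other Baer-type conditions.
\<close>

definition cs_baer :: "('o, 'm, 'r) abcat_scheme \<Rightarrow> 'i itself \<Rightarrow> 'o \<Rightarrow> 'o \<Rightarrow> bool" where
  "cs_baer C (_ :: 'i itself) M N \<longleftrightarrow>
    (\<forall>(I :: 'i set) f. (\<forall>i\<in>I. f i \<in> Hom C M N) \<longrightarrow>
      (\<exists>k. direct_summand C M k \<and> essential_in C (SubInter C M ((\<lambda>i. Kern C (f i)) ` I)) k))"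

definition strongly_cs_baer :: "('o, 'm, 'r) abcat_scheme \<Rightarrow> 'i itself \<Rightarrow> 'o \<Rightarrow> 'o \<Rightarrow> bool" where
  "strongly_cs_baer C (_ :: 'i itself) M N \<longleftrightarrow>
    (\<forall>(I :: 'i set) f. (\<forall>i\<in>I. f i \<in> Hom C M N) \<longrightarrow>
      (\<exists>k. direct_summand C M k \<and> fully_invariant C M k \<and>
        essential_in C (SubInter C M ((\<lambda>i. Kern C (f i)) ` I)) k))"

definition baer :: "('o, 'm, 'r) abcat_scheme \<Rightarrow> 'i itself \<Rightarrow> 'o \<Rightarrow> 'o \<Rightarrow> bool" where
  "baer C (_ :: 'i itself) M N \<longleftrightarrow>
    (\<forall>(I :: 'i set) f. (\<forall>i\<in>I. f i \<in> Hom C M N) \<longrightarrow>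
      direct_summand C M (SubInter C M ((\<lambda>i. Kern C (f i)) ` I)))"

definition strongly_baer :: "('o, 'm, 'r) abcat_scheme \<Rightarrow> 'i itself \<Rightarrow> 'o \<Rightarrow> 'o \<Rightarrow> bool" where
  "strongly_baer C (_ :: 'i itself) M N \<longleftrightarrow>
    (\<forall>(I :: 'i set) f. (\<forall>i\<in>I. f i \<in> Hom C M N) \<longrightarrow>
      direct_summand C M (SubInter C M ((\<lambda>i. Kern C (f i)) ` I)) \<and>
      fully_invariant C M (SubInter C M ((\<lambda>i. Kern C (f i)) ` I)))"

definition dual_cs_baer :: "('o, 'm, 'r) abcat_scheme \<Rightarrow> 'i itself \<Rightarrow> 'o \<Rightarrow> 'o \<Rightarrow> bool" where
  "dual_cs_baer C (_ :: 'i itself) M N \<longleftrightarrow>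
    (\<forall>(I :: 'i set) f. (\<forall>i\<in>I. f i \<in> Hom C M N) \<longrightarrow>
      (\<exists>k. direct_summand C N k \<and> lies_above C (SubSum C N ((\<lambda>i. Img C (f i)) ` I)) k))"

definition dual_strongly_cs_baer ::
  "('o, 'm, 'r) abcat_scheme \<Rightarrow> 'i itself \<Rightarrow> 'o \<Rightarrow> 'o \<Rightarrow> bool" where
  "dual_strongly_cs_baer C (_ :: 'i itself) M N \<longleftrightarrow>
    (\<forall>(I :: 'i set) f. (\<forall>i\<in>I. f i \<in> Hom C M N) \<longrightarrow>
      (\<exists>k. direct_summand C N k \<and> fully_invariant C N k \<and>
        lies_above C (SubSum C N ((\<lambda>i. Img C (f i)) ` I)) k))"

definition dual_baer :: "('o, 'm, 'r) abcat_scheme \<Rightarrow> 'i itself \<Rightarrow> 'o \<Rightarrow> 'o \<Rightarrow> bool" where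
  "dual_baer C (_ :: 'i itself) M N \<longleftrightarrow>
    (\<forall>(I :: 'i set) f. (\<forall>i\<in>I. f i \<in> Hom C M N) \<longrightarrow>
      direct_summand C N (SubSum C N ((\<lambda>i. Img C (f i)) ` I)))"

definition dual_strongly_baer ::
  "('o, 'm, 'r) abcat_scheme \<Rightarrow> 'i itself \<Rightarrow> 'o \<Rightarrow> 'o \<Rightarrow> bool" where
  "dual_strongly_baer C (_ :: 'i itself) M N \<longleftrightarrow>
    (\<forall>(I :: 'i set) f. (\<forall>i\<in>I. f i \<in> Hom C M N) \<longrightarrow>
      direct_summand C N (SubSum C N ((\<lambda>i. Img C (f i)) ` I)) \<and>
      fully_invariant C N (SubSum C N ((\<lambda>i. Img C (f i)) ` I)))"

text \<open>\<open>K_nonsingular C M N\<close> reads ``\<open>N\<close> is \<open>M\<close>-\<open>\<K>\<close>-nonsingular'' and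
  \<open>T_nonsingular C M N\<close> reads ``\<open>M\<close> is \<open>N\<close>-\<open>\<T>\<close>-nonsingular''.\<close>

definition K_nonsingular :: "('o, 'm, 'r) abcat_scheme \<Rightarrow> 'o \<Rightarrow> 'o \<Rightarrow> bool" where
  "K_nonsingular C M N \<longleftrightarrow>
    (\<forall>f \<in> Hom C M N. essential C M (Kern C f) \<longrightarrow> f = Zero C M N)"

definition T_nonsingular :: "('o, 'm, 'r) abcat_scheme \<Rightarrow> 'o \<Rightarrow> 'o \<Rightarrow> bool" where
  "T_nonsingular C M N \<longleftrightarrow>
    (\<forall>f \<in> Hom C M N. superfluous C N (Img C f) \<longrightarrow> f = Zero C M N)"

end

theory Submission
  imports Defs
begin

text \<open>
  If \<open>L = \<Inter> Ker f\<^sub>i\<close> is essential in a direct summand \<open>K\<close> of \<open>M\<close> with projection \<open>p\<close>, then each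
  \<open>f\<^sub>i k p\<close> has an essential kernel, so \<open>\<K>\<close>-nonsingularity makes it vanish; thus \<open>K \<subseteq> L\<close> and \<open>L = K\<close>.
  Conversely, an essential direct summand has zero complement, so a morphism whose kernel is one
  vanishes.  The second part is dual, with morphisms into \<open>M\<close> that factor through a subobject
  replaced by morphisms out of \<open>N\<close> that vanish on it.  In these terms intersections and sums have
  universal properties with respect to arbitrary morphisms, not only subobjects.
\<close>

text \<open>The bridge is that monomorphisms are kernels, so inclusion of subobjects is reverse
  inclusion of the classes of morphisms vanishing on them. Under this translation "a + x = B" says
  that \<open>a\<close> and \<open>x\<close> are jointly epi, and an image may be replaced by the
  morphism itself, so no epi-mono factorization has to be developed. A second obstacle is that
  \<open>SubInter\<close> and \<open>SubSum\<close> are mere choices, which mean something only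
  after an infimum or supremum has been constructed. For families, AB3* supplies it as the kernel of
  the induced M -> N^I, and AB3 as the image of the induced morphism from the coproduct of copies of
  M to N. The chosen representative agrees with such a construction only up to
  \<open>sub_eq\<close>, so being a summand and being fully invariant have to be transported along
  \<open>sub_eq\<close>.\<close>

context category
begin

section \<open>Morphisms and the preorder of subobjects in a category\<close>

lemma Hom_Arr: "f \<in> Hom C A B \<Longrightarrow> f \<in> Arr C"
  and Hom_Dom: "f \<in> Hom C A B \<Longrightarrow> Dom C f = A"
  and Hom_Cod: "f \<in> Hom C A B \<Longrightarrow> Cod C f = B"
  by (simp_all add: Hom_def)

lemma Hom_Obj: "f \<in> Hom C A B \<Longrightarrow> A \<in> Obj C \<and> B \<in> Obj C"
  using Dom_Obj Cod_Obj by (fastforce simp: Hom_def)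

lemma subobj_Hom: "subobj C M m \<Longrightarrow> m \<in> Hom C (Dom C m) M"
  by (auto simp: subobj_def is_mono_def Hom_def)

lemma subobj_cancel:
  "\<lbrakk>subobj C M m; x \<in> Hom C T (Dom C m); y \<in> Hom C T (Dom C m); m \<cdot> x = m \<cdot> y\<rbrakk> \<Longrightarrow> x = y"
  by (auto simp: subobj_def is_mono_def)

lemma subobjI:
  assumes m: "m \<in> Hom C A M"
    and cancel: "\<And>T x y. \<lbrakk>x \<in> Hom C T A; y \<in> Hom C T A; m \<cdot> x = m \<cdot> y\<rbrakk> \<Longrightarrow> x = y"
  shows "subobj C M m"
  unfolding subobj_def is_mono_def Hom_Dom[OF m]
  using Hom_Arr[OF m] Hom_Cod[OF m] cancel by blast

lemma is_epiI:
  assumes e: "e \<in> Hom C A B"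
    and cancel: "\<And>T x y. \<lbrakk>x \<in> Hom C B T; y \<in> Hom C B T; x \<cdot> e = y \<cdot> e\<rbrakk> \<Longrightarrow> x = y"
  shows "is_epi C e"
  unfolding is_epi_def Hom_Cod[OF e]
  using Hom_Arr[OF e] cancel by blast

lemma subobj_Ident: "A \<in> Obj C \<Longrightarrow> subobj C A (Ident C A)"
  using Ident_Comp by (intro subobjI[OF Ident_Hom]) auto

lemma subobj_split:
  assumes k: "k \<in> Hom C K M" and p: "p \<in> Hom C M K" and pk: "p \<cdot> k = Ident C K"
  shows "subobj C M k"
proof -
  have "x = y" if x: "x \<in> Hom C T K" and y: "y \<in> Hom C T K" and eq: "k \<cdot> x = k \<cdot> y" for T x y
  proof -
    have "(p \<cdot> k) \<cdot> x = (p \<cdot> k) \<cdot> y"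
      using Comp_assoc[OF x k p] Comp_assoc[OF y k p] eq by simp
    then show ?thesis
      using Ident_Comp[OF x] Ident_Comp[OF y] pk by simp
  qed
  then show ?thesis
    by (rule subobjI[OF k])
qed

lemma subobj_Comp:
  assumes m: "subobj C M m" and n: "subobj C (Dom C m) n"
  shows "subobj C M (m \<cdot> n)"
proof -
  note mh = subobj_Hom[OF m] and nh = subobj_Hom[OF n]
  note mn = Comp_Hom[OF nh mh]
  have "x = y" if x: "x \<in> Hom C T (Dom C n)" and y: "y \<in> Hom C T (Dom C n)"
    and eq: "(m \<cdot> n) \<cdot> x = (m \<cdot> n) \<cdot> y" for T x y
    using Comp_assoc[OF x nh mh] Comp_assoc[OF y nh mh] eq
    by (intro subobj_cancel[OF n x y] subobj_cancel[OF m Comp_Hom[OF x nh] Comp_Hom[OF y nh]]) simp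
  then show ?thesis
    by (rule subobjI[OF mn])
qed

lemma sub_leE:
  assumes "sub_le C t s" "t \<in> Hom C T M" "s \<in> Hom C S M"
  obtains u where "u \<in> Hom C T S" "s \<cdot> u = t"
  using assms(1) that unfolding sub_le_def Hom_Dom[OF assms(2)] Hom_Dom[OF assms(3)] by blast

lemma sub_leI: "\<lbrakk>s \<cdot> u = t; t \<in> Hom C T M; s \<in> Hom C S M; u \<in> Hom C T S\<rbrakk> \<Longrightarrow> sub_le C t s"
  unfolding sub_le_def using Hom_Dom by blast

lemma sub_le_refl: "t \<in> Hom C T M \<Longrightarrow> sub_le C t t"
  using Hom_Obj sub_leI[OF Comp_Ident _ _ Ident_Hom] by blast

lemma sub_le_Comp:
  assumes "s \<in> Hom C S M" "u \<in> Hom C T S"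
  shows "sub_le C (s \<cdot> u) s"
  using sub_leI[OF refl Comp_Hom[OF assms(2,1)] assms] .

lemma sub_le_trans:
  assumes "sub_le C r s" "sub_le C s t" "r \<in> Hom C R M" "s \<in> Hom C S M" "t \<in> Hom C T M"
  shows "sub_le C r t"
proof -
  obtain u where u: "u \<in> Hom C R S" "s \<cdot> u = r"
    using assms by (blast elim: sub_leE)
  obtain v where v: "v \<in> Hom C S T" "t \<cdot> v = s"
    using assms by (blast elim: sub_leE)
  show ?thesis
    using Comp_assoc[OF u(1) v(1) assms(5)] u v
    by (intro sub_leI[OF _ assms(3,5) Comp_Hom[OF u(1) v(1)]]) simp
qed

text \<open>An endomorphism of \<open>Dom C k\<close> is conjugated by the comparisons
  \<open>u\<close> and \<open>w\<close> between the two representatives.\<close>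

lemma fully_invariant_cong:
  assumes inv: "fully_invariant C M k" and l: "subobj C M l" and eq: "sub_eq C k l"
  shows "fully_invariant C M l"
proof -
  have "subobj C M k"
    using inv by (simp add: fully_invariant_def)
  note kh = subobj_Hom[OF this] and lh = subobj_Hom[OF l]
  obtain u where u: "u \<in> Hom C (Dom C l) (Dom C k)" "k \<cdot> u = l"
    using eq lh kh by (auto simp: sub_eq_def elim: sub_leE)
  obtain w where w: "w \<in> Hom C (Dom C k) (Dom C l)" "l \<cdot> w = k"
    using eq lh kh by (auto simp: sub_eq_def elim: sub_leE)
  have "\<exists>\<alpha> \<in> Hom C (Dom C l) (Dom C l). h \<cdot> l = l \<cdot> \<alpha>" if h: "h \<in> Hom C M M" for h
  proof -
    obtain \<alpha> where \<alpha>: "\<alpha> \<in> Hom C (Dom C k) (Dom C k)" "h \<cdot> k = k \<cdot> \<alpha>"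
      using inv h by (auto simp: fully_invariant_def)
    note \<alpha>u = Comp_Hom[OF u(1) \<alpha>(1)]
    have "h \<cdot> l = (h \<cdot> k) \<cdot> u"
      using Comp_assoc[OF u(1) kh h] u(2) by simp
    also have "\<dots> = (l \<cdot> w) \<cdot> (\<alpha> \<cdot> u)"
      using Comp_assoc[OF u(1) \<alpha>(1) kh] \<alpha>(2) w(2) by simp
    also have "\<dots> = l \<cdot> (w \<cdot> (\<alpha> \<cdot> u))"
      by (rule Comp_assoc[OF \<alpha>u w(1) lh])
    finally show ?thesis
      using Comp_Hom[OF \<alpha>u w(1)] by blast
  qed
  then show ?thesis
    using l by (simp add: fully_invariant_def)
qed

text \<open>The choice in \<open>SubInter\<close> is an infimum among monomorphisms only. A mono
  \<open>m\<close> with the universal property for all morphisms is such an infimum, and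
  \<open>m\<close> lies below the chosen one, so the stronger property passes to the choice.\<close>

lemma SubInter_le_iff:
  assumes m: "subobj C M m"
    and S: "\<And>s. s \<in> S \<Longrightarrow> subobj C M s"
    and univ: "\<And>T t. t \<in> Hom C T M \<Longrightarrow> sub_le C t m \<longleftrightarrow> (\<forall>s\<in>S. sub_le C t s)"
  shows "subobj C M (SubInter C M S)"
    and "t \<in> Hom C T M \<Longrightarrow> sub_le C t (SubInter C M S) \<longleftrightarrow> (\<forall>s\<in>S. sub_le C t s)"
proof -
  let ?n = "SubInter C M S"
  note mh = subobj_Hom[OF m]
  have "is_inter C M S m"
    unfolding is_inter_def
    using m univ[OF mh] sub_le_refl[OF mh] univ[OF subobj_Hom] by blast
  then have n: "is_inter C M S ?n"
    unfolding SubInter_def by (rule someI)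
  then show sub: "subobj C M ?n"
    by (simp add: is_inter_def)
  note nh = subobj_Hom[OF sub]
  have mn: "sub_le C m ?n"
    using n m univ[OF mh] sub_le_refl[OF mh] by (auto simp: is_inter_def)
  show "sub_le C t ?n \<longleftrightarrow> (\<forall>s\<in>S. sub_le C t s)" if t: "t \<in> Hom C T M"
  proof
    assume "sub_le C t ?n"
    then show "\<forall>s\<in>S. sub_le C t s"
      using n sub_le_trans[OF _ _ t nh subobj_Hom[OF S]] by (auto simp: is_inter_def)
  next
    assume "\<forall>s\<in>S. sub_le C t s"
    then show "sub_le C t ?n"
      using univ[OF t] sub_le_trans[OF _ mn t mh nh] by blast
  qed
qed

end

context abelian_category
begin

section \<open>Zero morphisms and differences\<close>

lemma Zero_Hom:
  assumes "A \<in> Obj C" "B \<in> Obj C"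
  shows "Zero C A B \<in> Hom C A B"
proof -
  interpret G: comm_group "\<lparr>carrier = Hom C A B, monoid.mult = Add C, one = Zero C A B\<rparr>"
    using assms by (rule Hom_group)
  show ?thesis
    using G.one_closed by simp
qed

lemma Zero_Add:
  assumes f: "f \<in> Hom C A B"
  shows "Zero C A B \<oplus>\<^sub>h f = f"
proof -
  interpret G: comm_group "\<lparr>carrier = Hom C A B, monoid.mult = Add C, one = Zero C A B\<rparr>"
    using Hom_group Hom_Obj[OF f] by simp
  show ?thesis
    using G.l_one[of f] f by simp
qed

text \<open>Source of the absorption laws for zero, which are not axioms: 0 + 0 = 0 and
  distributivity make a composite with zero idempotent under addition.\<close>

lemma Add_self_eq_Zero:
  assumes "f \<in> Hom C A B" "f \<oplus>\<^sub>h f = f"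
  shows "f = Zero C A B"
proof -
  interpret G: comm_group "\<lparr>carrier = Hom C A B, monoid.mult = Add C, one = Zero C A B\<rparr>"
    using Hom_group Hom_Obj[OF assms(1)] by simp
  show ?thesis
    using G.r_cancel_one[of f f] assms by simp
qed

lemma Comp_Zero:
  assumes "f \<in> Hom C A B" "T \<in> Obj C"
  shows "f \<cdot> Zero C T A = Zero C T B"
proof -
  have z: "Zero C T A \<in> Hom C T A"
    using Zero_Hom assms(2) Hom_Obj[OF assms(1)] by blast
  show ?thesis
    using Comp_Add_right[OF z z assms(1)] Zero_Add[OF z]
    by (intro Add_self_eq_Zero[OF Comp_Hom[OF z assms(1)]]) simp
qed

lemma Zero_Comp:
  assumes "f \<in> Hom C A B" "T \<in> Obj C"
  shows "Zero C B T \<cdot> f = Zero C A T"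
proof -
  have z: "Zero C B T \<in> Hom C B T"
    using Zero_Hom assms(2) Hom_Obj[OF assms(1)] by blast
  show ?thesis
    using Comp_Add_left[OF assms(1) z z] Zero_Add[OF z]
    by (intro Add_self_eq_Zero[OF Comp_Hom[OF assms(1) z]]) simp
qed

text \<open>The record has no negation, so differences are taken in the Hom group. They reduce
  cancellation of \<open>m\<close> or \<open>e\<close> to a statement about zero.\<close>

lemma subtract:
  assumes x: "x \<in> Hom C A B" and y: "y \<in> Hom C A B"
  obtains d where "d \<in> Hom C A B" "d \<oplus>\<^sub>h y = x"
proof -
  let ?G = "\<lparr>carrier = Hom C A B, monoid.mult = Add C, one = Zero C A B\<rparr>"
  interpret G: comm_group ?G
    using Hom_group Hom_Obj[OF x] by simp
  let ?d = "x \<otimes>\<^bsub>?G\<^esub> inv\<^bsub>?G\<^esub> y"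
  have "x \<in> carrier ?G" "y \<in> carrier ?G"
    using x y by simp_all
  then have "?d \<in> carrier ?G" "x = ?d \<otimes>\<^bsub>?G\<^esub> y"
    using G.inv_solve_right[of ?d x y] by blast+
  then show ?thesis
    using that by simp
qed

lemma Add_right_cancel:
  assumes "x \<in> Hom C A B" "y \<in> Hom C A B" "x \<oplus>\<^sub>h y = y"
  shows "x = Zero C A B"
proof -
  interpret G: comm_group "\<lparr>carrier = Hom C A B, monoid.mult = Add C, one = Zero C A B\<rparr>"
    using Hom_group Hom_Obj[OF assms(1)] by simp
  show ?thesis
    using G.r_cancel_one[of y x] G.l_cancel_one[of y x] assms by simp
qed

lemma subobjI_Zero:
  assumes m: "m \<in> Hom C A B"
    and zero: "\<And>T t. \<lbrakk>t \<in> Hom C T A; m \<cdot> t = Zero C T B\<rbrakk> \<Longrightarrow> t = Zero C T A"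
  shows "subobj C B m"
proof -
  have "x = y" if x: "x \<in> Hom C T A" and y: "y \<in> Hom C T A" and eq: "m \<cdot> x = m \<cdot> y" for T x y
  proof -
    obtain d where d: "d \<in> Hom C T A" "d \<oplus>\<^sub>h y = x"
      using subtract[OF x y] .
    have "(m \<cdot> d) \<oplus>\<^sub>h (m \<cdot> y) = m \<cdot> y"
      using Comp_Add_right[OF d(1) y m] d(2) eq by simp
    then have "d = Zero C T A"
      using zero[OF d(1)] Add_right_cancel[OF Comp_Hom[OF d(1) m] Comp_Hom[OF y m]] by simp
    then show ?thesis
      using d(2) Zero_Add[OF y] by simp
  qed
  then show ?thesis
    by (rule subobjI[OF m])
qed

lemma is_epiI_Zero:
  assumes e: "e \<in> Hom C A B"
    and zero: "\<And>T t. \<lbrakk>t \<in> Hom C B T; t \<cdot> e = Zero C A T\<rbrakk> \<Longrightarrow> t = Zero C B T"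
  shows "is_epi C e"
proof -
  have "x = y" if x: "x \<in> Hom C B T" and y: "y \<in> Hom C B T" and eq: "x \<cdot> e = y \<cdot> e" for T x y
  proof -
    obtain d where d: "d \<in> Hom C B T" "d \<oplus>\<^sub>h y = x"
      using subtract[OF x y] .
    have "(d \<cdot> e) \<oplus>\<^sub>h (y \<cdot> e) = y \<cdot> e"
      using Comp_Add_left[OF e d(1) y] d(2) eq by simp
    then have "d = Zero C B T"
      using zero[OF d(1)] Add_right_cancel[OF Comp_Hom[OF e d(1)] Comp_Hom[OF e y]] by simp
    then show ?thesis
      using d(2) Zero_Add[OF y] by simp
  qed
  then show ?thesis
    by (rule is_epiI[OF e])
qed

section \<open>Kernels and cokernels as tests for vanishing\<close>

lemma is_kernelD:
  assumes k: "is_kernel C f k" and f: "f \<in> Hom C A B"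
  shows "k \<in> Hom C (Dom C k) A" "f \<cdot> k = Zero C (Dom C k) B"
    "\<lbrakk>t \<in> Hom C T A; f \<cdot> t = Zero C T B\<rbrakk> \<Longrightarrow> \<exists>!u. u \<in> Hom C T (Dom C k) \<and> k \<cdot> u = t"
proof -
  note D = k[unfolded is_kernel_def Hom_Dom[OF f] Hom_Cod[OF f]]
  show "k \<in> Hom C (Dom C k) A"
    using D by (simp add: Hom_def)
  show "f \<cdot> k = Zero C (Dom C k) B"
    using D by blast
  show "\<lbrakk>t \<in> Hom C T A; f \<cdot> t = Zero C T B\<rbrakk> \<Longrightarrow> \<exists>!u. u \<in> Hom C T (Dom C k) \<and> k \<cdot> u = t"
    using D by blast
qed

lemma is_cokernelD:
  assumes q: "is_cokernel C f q" and f: "f \<in> Hom C A B"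
  shows "q \<in> Hom C B (Cod C q)" "q \<cdot> f = Zero C A (Cod C q)"
    "\<lbrakk>t \<in> Hom C B T; t \<cdot> f = Zero C A T\<rbrakk> \<Longrightarrow> \<exists>!u. u \<in> Hom C (Cod C q) T \<and> u \<cdot> q = t"
proof -
  note D = q[unfolded is_cokernel_def Hom_Dom[OF f] Hom_Cod[OF f]]
  show "q \<in> Hom C B (Cod C q)"
    using D by (simp add: Hom_def)
  show "q \<cdot> f = Zero C A (Cod C q)"
    using D by blast
  show "\<lbrakk>t \<in> Hom C B T; t \<cdot> f = Zero C A T\<rbrakk> \<Longrightarrow> \<exists>!u. u \<in> Hom C (Cod C q) T \<and> u \<cdot> q = t"
    using D by blast
qed

lemma is_kernel_subobj:
  assumes k: "is_kernel C f k" and f: "f \<in> Hom C A B"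
  shows "subobj C A k"
proof (rule subobjI)
  note kD = is_kernelD[OF k f]
  show "k \<in> Hom C (Dom C k) A"
    by (rule kD)
  fix T x y
  assume x: "x \<in> Hom C T (Dom C k)" and y: "y \<in> Hom C T (Dom C k)" and eq: "k \<cdot> x = k \<cdot> y"
  have "f \<cdot> (k \<cdot> x) = Zero C T B"
    using Comp_assoc[OF x kD(1) f] kD(2) Zero_Comp[OF x, of B] Hom_Obj[OF f] by simp
  from kD(3)[OF Comp_Hom[OF x kD(1)] this] show "x = y"
    using x y eq by metis
qed

lemma is_kernel_le_iff:
  assumes k: "is_kernel C f k" and f: "f \<in> Hom C A B" and t: "t \<in> Hom C T A"
  shows "sub_le C t k \<longleftrightarrow> f \<cdot> t = Zero C T B"
proof
  note kD = is_kernelD[OF k f]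
  assume "sub_le C t k"
  then obtain u where u: "u \<in> Hom C T (Dom C k)" "k \<cdot> u = t"
    using t kD(1) by (blast elim: sub_leE)
  show "f \<cdot> t = Zero C T B"
    using kD(2) Comp_assoc[OF u(1) kD(1) f] Zero_Comp[OF u(1), of B] Hom_Obj[OF f] u(2) by simp
next
  note kD = is_kernelD[OF k f]
  assume "f \<cdot> t = Zero C T B"
  from kD(3)[OF t this] show "sub_le C t k"
    using sub_leI[OF _ t kD(1)] by blast
qed

lemma is_cokernel_iff:
  assumes q: "is_cokernel C f q" and f: "f \<in> Hom C A B" and t: "t \<in> Hom C B T"
  shows "(\<exists>u \<in> Hom C (Cod C q) T. u \<cdot> q = t) \<longleftrightarrow> t \<cdot> f = Zero C A T"
proof
  note qD = is_cokernelD[OF q f]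
  assume "\<exists>u \<in> Hom C (Cod C q) T. u \<cdot> q = t"
  then obtain u where u: "u \<in> Hom C (Cod C q) T" "u \<cdot> q = t"
    by blast
  show "t \<cdot> f = Zero C A T"
    using qD(2) Comp_assoc[OF f qD(1) u(1)] Comp_Zero[OF u(1), of A] Hom_Obj[OF f] u(2) by simp
next
  assume "t \<cdot> f = Zero C A T"
  from is_cokernelD(3)[OF q f t this] show "\<exists>u \<in> Hom C (Cod C q) T. u \<cdot> q = t"
    by blast
qed

lemma is_kernel_Kern: "f \<in> Hom C A B \<Longrightarrow> is_kernel C f (Kern C f)"
  unfolding Kern_def using someI_ex[OF kernel_ex[OF Hom_Arr]] .

lemma is_cokernel_Cokern: "f \<in> Hom C A B \<Longrightarrow> is_cokernel C f (Cokern C f)"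
  unfolding Cokern_def using someI_ex[OF cokernel_ex[OF Hom_Arr]] .

lemma subobj_Kern: "f \<in> Hom C A B \<Longrightarrow> subobj C A (Kern C f)"
  by (rule is_kernel_subobj[OF is_kernel_Kern])

lemma Kern_le_iff:
  "\<lbrakk>f \<in> Hom C A B; t \<in> Hom C T A\<rbrakk> \<Longrightarrow> sub_le C t (Kern C f) \<longleftrightarrow> f \<cdot> t = Zero C T B"
  by (rule is_kernel_le_iff[OF is_kernel_Kern])

lemma Cokern_Hom: "f \<in> Hom C A B \<Longrightarrow> Cokern C f \<in> Hom C B (Cod C (Cokern C f))"
  by (rule is_cokernelD(1)[OF is_cokernel_Cokern])

lemma Cokern_Comp: "f \<in> Hom C A B \<Longrightarrow> Cokern C f \<cdot> f = Zero C A (Cod C (Cokern C f))"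
  by (rule is_cokernelD(2)[OF is_cokernel_Cokern])

lemma Cokern_factor_iff:
  "\<lbrakk>f \<in> Hom C A B; t \<in> Hom C B T\<rbrakk> \<Longrightarrow>
    (\<exists>u \<in> Hom C (Cod C (Cokern C f)) T. u \<cdot> Cokern C f = t) \<longleftrightarrow> t \<cdot> f = Zero C A T"
  by (rule is_cokernel_iff[OF is_cokernel_Cokern])

text \<open>Cokernels are epi: \<open>w\<close> and the zero morphism both factor zero through
  \<open>Cokern C f\<close>, and such a factorization is unique.\<close>

lemma Cokern_cancel_Zero:
  assumes f: "f \<in> Hom C A B" and w: "w \<in> Hom C (Cod C (Cokern C f)) T"
    and zero: "w \<cdot> Cokern C f = Zero C B T"
  shows "w = Zero C (Cod C (Cokern C f)) T"
proof -
  have B: "B \<in> Obj C" and T: "T \<in> Obj C"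
    using Hom_Obj[OF f] Hom_Obj[OF w] by simp_all
  have "Zero C (Cod C (Cokern C f)) T \<in> Hom C (Cod C (Cokern C f)) T"
    "Zero C (Cod C (Cokern C f)) T \<cdot> Cokern C f = Zero C B T"
    using Hom_Obj[OF w] Zero_Hom Zero_Comp[OF Cokern_Hom[OF f]] by auto
  with is_cokernelD(3)[OF is_cokernel_Cokern[OF f] f Zero_Hom[OF B T] Zero_Comp[OF f T]]
  show ?thesis
    using w zero by metis
qed

text \<open>Every subobject is a kernel, so it is determined by the morphisms that vanish on it.\<close>

lemma sub_le_iff_Zero:
  assumes m: "subobj C M m" and t: "t \<in> Hom C T M"
  shows "sub_le C t m \<longleftrightarrow>
    (\<forall>B. \<forall>g \<in> Hom C M B. g \<cdot> m = Zero C (Dom C m) B \<longrightarrow> g \<cdot> t = Zero C T B)"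
proof
  note mh = subobj_Hom[OF m]
  assume "sub_le C t m"
  then obtain u where u: "u \<in> Hom C T (Dom C m)" "m \<cdot> u = t"
    using t mh by (blast elim: sub_leE)
  show "\<forall>B. \<forall>g \<in> Hom C M B. g \<cdot> m = Zero C (Dom C m) B \<longrightarrow> g \<cdot> t = Zero C T B"
    using u Comp_assoc[OF u(1) mh] Zero_Comp[OF u(1)] Hom_Obj by metis
next
  note mh = subobj_Hom[OF m]
  assume *: "\<forall>B. \<forall>g \<in> Hom C M B. g \<cdot> m = Zero C (Dom C m) B \<longrightarrow> g \<cdot> t = Zero C T B"
  obtain g where g: "is_kernel C g m"
    using m mono_is_kernel by (auto simp: subobj_def)
  then have gh: "g \<in> Hom C M (Cod C g)"
    using mh by (auto simp: is_kernel_def Hom_def)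
  have "g \<cdot> m = Zero C (Dom C m) (Cod C g)"
    using g by (simp add: is_kernel_def)
  then show "sub_le C t m"
    using * gh is_kernel_le_iff[OF g gh t] by blast
qed

lemma subobj_Img: "f \<in> Hom C A B \<Longrightarrow> subobj C B (Img C f)"
  unfolding Img_def by (rule subobj_Kern[OF Cokern_Hom])

text \<open>Here \<open>Img\<close> is the kernel of the cokernel. A morphism that kills
  \<open>f\<close> factors through the cokernel, which kills the image; conversely \<open>f\<close>
  factors through the image.\<close>

lemma Comp_Img_Zero_iff:
  assumes f: "f \<in> Hom C A B" and g: "g \<in> Hom C B T"
  shows "g \<cdot> Img C f = Zero C (Dom C (Img C f)) T \<longleftrightarrow> g \<cdot> f = Zero C A T"
proof
  note i = subobj_Img[OF f]
  note ih = subobj_Hom[OF i] and q = Cokern_Hom[OF f]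
  have "sub_le C f (Img C f)"
    unfolding Img_def using Kern_le_iff[OF q f] Cokern_Comp[OF f] by simp
  then show "g \<cdot> f = Zero C A T" if "g \<cdot> Img C f = Zero C (Dom C (Img C f)) T"
    using sub_le_iff_Zero[OF i f] g that by blast
next
  note i = subobj_Img[OF f]
  note ih = subobj_Hom[OF i] and q = Cokern_Hom[OF f]
  assume "g \<cdot> f = Zero C A T"
  then obtain u where u: "u \<in> Hom C (Cod C (Cokern C f)) T" "u \<cdot> Cokern C f = g"
    using Cokern_factor_iff[OF f g] by blast
  have "Cokern C f \<cdot> Img C f = Zero C (Dom C (Img C f)) (Cod C (Cokern C f))"
    using Kern_le_iff[OF q ih] sub_le_refl[OF ih] by (simp add: Img_def)
  then show "g \<cdot> Img C f = Zero C (Dom C (Img C f)) T"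
    using Comp_assoc[OF ih q u(1)] u Comp_Zero[OF u(1)] Hom_Obj[OF ih] by simp
qed

text \<open>Counterpart of \<open>SubInter_le_iff\<close>: by \<open>sub_le_iff_Zero\<close>,
  comparing subobjects means comparing which morphisms kill them, so \<open>univ\<close> makes
  \<open>m\<close> a supremum, and the chosen supremum is killed by the same morphisms.\<close>

lemma SubSum_Zero_iff:
  assumes m: "subobj C N m"
    and S: "\<And>s. s \<in> S \<Longrightarrow> subobj C N s"
    and univ: "\<And>T g. g \<in> Hom C N T \<Longrightarrow>
      g \<cdot> m = Zero C (Dom C m) T \<longleftrightarrow> (\<forall>s\<in>S. g \<cdot> s = Zero C (Dom C s) T)"
  shows "subobj C N (SubSum C N S)"
    and "g \<in> Hom C N T \<Longrightarrow> g \<cdot> SubSum C N S = Zero C (Dom C (SubSum C N S)) T \<longleftrightarrow>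
      (\<forall>s\<in>S. g \<cdot> s = Zero C (Dom C s) T)"
proof -
  let ?n = "SubSum C N S"
  note mh = subobj_Hom[OF m]
  have least: "sub_le C m n" if n: "subobj C N n" and le: "\<forall>s\<in>S. sub_le C s n" for n
    using le univ sub_le_iff_Zero[OF n mh] sub_le_iff_Zero[OF n subobj_Hom[OF S]] by blast
  have upper: "\<forall>s\<in>S. sub_le C s m"
    using univ sub_le_iff_Zero[OF m subobj_Hom[OF S]] by blast
  have "is_sum C N S m"
    using m least upper by (simp add: is_sum_def)
  then have n: "is_sum C N S ?n"
    unfolding SubSum_def by (rule someI)
  then show sub: "subobj C N ?n"
    by (simp add: is_sum_def)
  have nm: "sub_le C ?n m"
    using n m upper by (simp add: is_sum_def)
  show "g \<cdot> ?n = Zero C (Dom C ?n) T \<longleftrightarrow> (\<forall>s\<in>S. g \<cdot> s = Zero C (Dom C s) T)"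
    if g: "g \<in> Hom C N T"
  proof
    assume "g \<cdot> ?n = Zero C (Dom C ?n) T"
    then show "\<forall>s\<in>S. g \<cdot> s = Zero C (Dom C s) T"
      using n g sub_le_iff_Zero[OF sub subobj_Hom[OF S]] by (auto simp: is_sum_def)
  next
    assume "\<forall>s\<in>S. g \<cdot> s = Zero C (Dom C s) T"
    then show "g \<cdot> ?n = Zero C (Dom C ?n) T"
      using univ[OF g] g nm sub_le_iff_Zero[OF m subobj_Hom[OF sub]] by blast
  qed
qed

text \<open>If a mono is zero, cancelling it makes the identity of its domain zero, and then every
  morphism into or out of that domain vanishes.\<close>

lemma is_zero_object_Dom_iff:
  assumes x: "subobj C M x"
  shows "is_zero_object C (Dom C x) \<longleftrightarrow> x = Zero C (Dom C x) M"
proof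
  note xh = subobj_Hom[OF x]
  assume "is_zero_object C (Dom C x)"
  then have "\<exists>!f. f \<in> Hom C (Dom C x) M"
    using Hom_Obj[OF xh] by (simp add: is_zero_object_def)
  then show "x = Zero C (Dom C x) M"
    using xh Zero_Hom[of "Dom C x" M] Hom_Obj[OF xh] by blast
next
  note xh = subobj_Hom[OF x]
  assume zero: "x = Zero C (Dom C x) M"
  let ?X = "Dom C x"
  have X: "?X \<in> Obj C"
    using Hom_Obj[OF xh] by blast
  have "Ident C ?X = Zero C ?X ?X"
    using Comp_Ident[OF xh] Comp_Zero[OF xh X] zero
    by (intro subobj_cancel[OF x Ident_Hom[OF X] Zero_Hom[OF X X]]) simp
  then have "f = Zero C A ?X" if "f \<in> Hom C A ?X" for f A
    using Ident_Comp[OF that] Zero_Comp[OF that X] by simp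
  moreover have "f = Zero C ?X A" if "f \<in> Hom C ?X A" for f A
    using Comp_Ident[OF that] Comp_Zero[OF that X] \<open>Ident C ?X = Zero C ?X ?X\<close> by simp
  ultimately show "is_zero_object C ?X"
    using X Zero_Hom[OF X] Zero_Hom[OF _ X] unfolding is_zero_object_def by metis
qed

text \<open>The intersection is built as the part of \<open>x\<close> killed by the quotient B ->
  B/a, that is \<open>x\<close> composed with the kernel of \<open>?q\<close> after
  \<open>x\<close>. This works because \<open>a\<close> is the kernel of its own cokernel, which is
  \<open>a_iff\<close>.\<close>

lemma SubInter_pair:
  assumes a: "subobj C B a" and x: "subobj C B x"
  shows "subobj C B (SubInter C B {a, x})"
    and "t \<in> Hom C T B \<Longrightarrow> sub_le C t (SubInter C B {a, x}) \<longleftrightarrow> sub_le C t a \<and> sub_le C t x"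
proof -
  note ah = subobj_Hom[OF a] and xh = subobj_Hom[OF x]
  note q = Cokern_Hom[OF ah]
  let ?q = "Cokern C a"
  let ?k = "Kern C (?q \<cdot> x)"
  note qx = Comp_Hom[OF xh q]
  note k = subobj_Kern[OF qx]
  note kh = subobj_Hom[OF k]
  have a_iff: "sub_le C t a \<longleftrightarrow> ?q \<cdot> t = Zero C T (Cod C ?q)" if t: "t \<in> Hom C T B" for T t
  proof
    assume "sub_le C t a"
    then show "?q \<cdot> t = Zero C T (Cod C ?q)"
      using sub_le_iff_Zero[OF a t] q Cokern_Comp[OF ah] by blast
  next
    assume zero: "?q \<cdot> t = Zero C T (Cod C ?q)"
    have "g \<cdot> t = Zero C T D" if g: "g \<in> Hom C B D" "g \<cdot> a = Zero C (Dom C a) D" for D g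
    proof -
      obtain u where u: "u \<in> Hom C (Cod C ?q) D" "u \<cdot> ?q = g"
        using Cokern_factor_iff[OF ah g(1)] g(2) by blast
      show ?thesis
        using Comp_assoc[OF t q u(1)] u(2) zero Comp_Zero[OF u(1)] Hom_Obj[OF t] by simp
    qed
    then show "sub_le C t a"
      using sub_le_iff_Zero[OF a t] by blast
  qed
  have univ: "sub_le C t (x \<cdot> ?k) \<longleftrightarrow> (\<forall>s\<in>{a, x}. sub_le C t s)" if t: "t \<in> Hom C T B" for T t
  proof
    note xk = Comp_Hom[OF kh xh]
    have "?q \<cdot> (x \<cdot> ?k) = Zero C (Dom C ?k) (Cod C ?q)"
      using Kern_le_iff[OF qx kh] sub_le_refl[OF kh] Comp_assoc[OF kh xh q] by simp
    then have "sub_le C (x \<cdot> ?k) a"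
      using a_iff[OF xk] by blast
    moreover assume "sub_le C t (x \<cdot> ?k)"
    ultimately show "\<forall>s\<in>{a, x}. sub_le C t s"
      using sub_le_trans[OF _ _ t xk ah] sub_le_trans[OF _ sub_le_Comp[OF xh kh] t xk xh] by blast
  next
    assume *: "\<forall>s\<in>{a, x}. sub_le C t s"
    then obtain u where u: "u \<in> Hom C T (Dom C x)" "x \<cdot> u = t"
      using t xh by (blast elim: sub_leE)
    have "sub_le C u ?k"
      using Kern_le_iff[OF qx u(1)] Comp_assoc[OF u(1) xh q] u(2) a_iff[OF t] * by simp
    then obtain v where v: "v \<in> Hom C T (Dom C ?k)" "?k \<cdot> v = u"
      using u kh by (blast elim: sub_leE)
    show "sub_le C t (x \<cdot> ?k)"
      using Comp_assoc[OF v(1) kh xh] u v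
      by (intro sub_leI[OF _ t Comp_Hom[OF kh xh] v(1)]) simp
  qed
  have sub: "subobj C B s" if "s \<in> {a, x}" for s
    using that a x by blast
  note main = SubInter_le_iff[OF subobj_Comp[OF x k] sub univ]
  show "subobj C B (SubInter C B {a, x})"
    by (rule main(1))
  show "sub_le C t (SubInter C B {a, x}) \<longleftrightarrow> sub_le C t a \<and> sub_le C t x" if "t \<in> Hom C T B"
    using main(2)[OF _ _ that] by simp
qed

text \<open>Eliminates the chosen intersection: its domain is zero exactly when every morphism
  through both \<open>a\<close> and \<open>x\<close> vanishes, the intersection itself being one of
  these.\<close>

lemma essential_iff:
  "essential C B a \<longleftrightarrow> subobj C B a \<and>
    (\<forall>x. subobj C B x \<and> (\<forall>T. \<forall>t \<in> Hom C T B. sub_le C t a \<and> sub_le C t x \<longrightarrow> t = Zero C T B)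
      \<longrightarrow> x = Zero C (Dom C x) B)"
proof -
  have "is_zero_object C (Dom C (SubInter C B {a, x})) \<longleftrightarrow>
      (\<forall>T. \<forall>t \<in> Hom C T B. sub_le C t a \<and> sub_le C t x \<longrightarrow> t = Zero C T B)"
    if a: "subobj C B a" and x: "subobj C B x" for x
  proof -
    let ?m = "SubInter C B {a, x}"
    note m = SubInter_pair[OF a x]
    note mh = subobj_Hom[OF m(1)]
    have "t = Zero C T B" if "?m = Zero C (Dom C ?m) B" "t \<in> Hom C T B" "sub_le C t ?m" for T t
    proof -
      obtain u where u: "u \<in> Hom C T (Dom C ?m)" "?m \<cdot> u = t"
        using \<open>sub_le C t ?m\<close> \<open>t \<in> _\<close> mh by (blast elim: sub_leE)
      show ?thesis
        using Zero_Comp[OF u(1), of B] Hom_Obj[OF mh] that(1) u(2) by simp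
    qed
    then show ?thesis
      using is_zero_object_Dom_iff[OF m(1)] m(2) m(2)[OF mh] sub_le_refl[OF mh] mh by blast
  qed
  then show ?thesis
    unfolding essential_def using is_zero_object_Dom_iff by blast
qed

text \<open>The sum is the kernel of a two-step quotient: first by \<open>a\<close>, then by the
  image of \<open>x\<close> in B/a. A morphism that kills both \<open>a\<close> and \<open>x\<close>
  factors through both steps.\<close>

lemma SubSum_pair:
  assumes a: "subobj C B a" and x: "subobj C B x"
  shows "subobj C B (SubSum C B {a, x})"
    and "g \<in> Hom C B T \<Longrightarrow> g \<cdot> SubSum C B {a, x} = Zero C (Dom C (SubSum C B {a, x})) T \<longleftrightarrow>
      g \<cdot> a = Zero C (Dom C a) T \<and> g \<cdot> x = Zero C (Dom C x) T"
proof -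
  note ah = subobj_Hom[OF a] and xh = subobj_Hom[OF x]
  note q = Cokern_Hom[OF ah]
  let ?q = "Cokern C a"
  let ?r = "Cokern C (?q \<cdot> x)"
  note qx = Comp_Hom[OF xh q]
  note r = Cokern_Hom[OF qx]
  note rq = Comp_Hom[OF q r]
  let ?m = "Kern C (?r \<cdot> ?q)"
  note m = subobj_Kern[OF rq]
  note mh = subobj_Hom[OF m]
  have univ: "g \<cdot> ?m = Zero C (Dom C ?m) T \<longleftrightarrow> (\<forall>s\<in>{a, x}. g \<cdot> s = Zero C (Dom C s) T)"
    if g: "g \<in> Hom C B T" for T g
  proof
    assume gm: "g \<cdot> ?m = Zero C (Dom C ?m) T"
    have "(?r \<cdot> ?q) \<cdot> a = Zero C (Dom C a) (Cod C ?r)"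
      using Comp_assoc[OF ah q r] Cokern_Comp[OF ah] Comp_Zero[OF r] Hom_Obj[OF ah] by simp
    then have "sub_le C a ?m"
      using Kern_le_iff[OF rq ah] by blast
    moreover have "sub_le C x ?m"
      using Kern_le_iff[OF rq xh] Comp_assoc[OF xh q r] Cokern_Comp[OF qx] by simp
    ultimately show "\<forall>s\<in>{a, x}. g \<cdot> s = Zero C (Dom C s) T"
      using sub_le_iff_Zero[OF m ah] sub_le_iff_Zero[OF m xh] g gm by blast
  next
    assume *: "\<forall>s\<in>{a, x}. g \<cdot> s = Zero C (Dom C s) T"
    then obtain u where u: "u \<in> Hom C (Cod C ?q) T" "u \<cdot> ?q = g"
      using Cokern_factor_iff[OF ah g] by blast
    have "u \<cdot> (?q \<cdot> x) = Zero C (Dom C x) T"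
      using Comp_assoc[OF xh q u(1)] u(2) * by simp
    then obtain w where w: "w \<in> Hom C (Cod C ?r) T" "w \<cdot> ?r = u"
      using Cokern_factor_iff[OF qx u(1)] by blast
    have "g = w \<cdot> (?r \<cdot> ?q)"
      using Comp_assoc[OF q r w(1)] u w by simp
    moreover have "(?r \<cdot> ?q) \<cdot> ?m = Zero C (Dom C ?m) (Cod C ?r)"
      using Kern_le_iff[OF rq mh] sub_le_refl[OF mh] by blast
    ultimately show "g \<cdot> ?m = Zero C (Dom C ?m) T"
      using Comp_assoc[OF mh rq w(1)] Comp_Zero[OF w(1)] Hom_Obj[OF mh] by simp
  qed
  have sub: "subobj C B s" if "s \<in> {a, x}" for s
    using that a x by blast
  note main = SubSum_Zero_iff[OF m sub univ]
  show "subobj C B (SubSum C B {a, x})"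
    by (rule main(1))
  show "g \<cdot> SubSum C B {a, x} = Zero C (Dom C (SubSum C B {a, x})) T \<longleftrightarrow>
      g \<cdot> a = Zero C (Dom C a) T \<and> g \<cdot> x = Zero C (Dom C x) T" if "g \<in> Hom C B T"
    using main(2)[OF _ _ that] by simp
qed

lemma sub_eq_Ident_iff:
  assumes x: "subobj C B x"
  shows "sub_eq C x (Ident C B) \<longleftrightarrow>
    (\<forall>T. \<forall>g \<in> Hom C B T. g \<cdot> x = Zero C (Dom C x) T \<longrightarrow> g = Zero C B T)"
proof -
  note xh = subobj_Hom[OF x]
  have B: "B \<in> Obj C"
    using Hom_Obj[OF xh] by blast
  note i = Ident_Hom[OF B]
  have "sub_le C x (Ident C B)"
    using sub_leI[OF Ident_Comp[OF xh] xh i xh] .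
  then show ?thesis
    using sub_le_iff_Zero[OF x i] by (auto simp: sub_eq_def Comp_Ident)
qed

text \<open>Eliminates the chosen sum: "a + x = B" becomes joint epimorphy of \<open>a\<close> and
  \<open>x\<close>, and "x = B" becomes epimorphy of \<open>x\<close>.\<close>

lemma superfluous_iff:
  "superfluous C B a \<longleftrightarrow> subobj C B a \<and>
    (\<forall>x. subobj C B x \<and> (\<forall>T. \<forall>g \<in> Hom C B T.
        g \<cdot> a = Zero C (Dom C a) T \<and> g \<cdot> x = Zero C (Dom C x) T \<longrightarrow> g = Zero C B T)
      \<longrightarrow> (\<forall>T. \<forall>g \<in> Hom C B T. g \<cdot> x = Zero C (Dom C x) T \<longrightarrow> g = Zero C B T))"
proof -
  have "sub_eq C (SubSum C B {a, x}) (Ident C B) \<longleftrightarrow> (\<forall>T. \<forall>g \<in> Hom C B T.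
      g \<cdot> a = Zero C (Dom C a) T \<and> g \<cdot> x = Zero C (Dom C x) T \<longrightarrow> g = Zero C B T)"
    if a: "subobj C B a" and x: "subobj C B x" for x
    unfolding sub_eq_Ident_iff[OF SubSum_pair(1)[OF a x]] using SubSum_pair(2)[OF a x] by blast
  then show ?thesis
    unfolding superfluous_def using sub_eq_Ident_iff by blast
qed

section \<open>Change of representative; kernels and images of families\<close>

lemma direct_summand_cong:
  assumes k: "direct_summand C M k" and l: "subobj C M l" and eq: "sub_eq C k l"
  shows "direct_summand C M l"
proof -
  obtain k' p p' where bi: "is_biproduct C (Dom C k) (Dom C k') M k k' p p'"
    using k by (auto simp: direct_summand_def)
  then have kh: "k \<in> Hom C (Dom C k) M" and k'h: "k' \<in> Hom C (Dom C k') M"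
    and p: "p \<in> Hom C M (Dom C k)" and p': "p' \<in> Hom C M (Dom C k')"
    by (auto simp: is_biproduct_def)
  note lh = subobj_Hom[OF l]
  have L: "Dom C l \<in> Obj C"
    using Hom_Obj[OF lh] by blast
  obtain u where u: "u \<in> Hom C (Dom C l) (Dom C k)" "k \<cdot> u = l"
    using eq lh kh by (auto simp: sub_eq_def elim: sub_leE)
  obtain w where w: "w \<in> Hom C (Dom C k) (Dom C l)" "l \<cdot> w = k"
    using eq lh kh by (auto simp: sub_eq_def elim: sub_leE)
  \<comment> \<open>The complement \<open>k'\<close> is kept, and the new projection is
    \<open>p\<close> followed by the comparison \<open>w\<close>.\<close>
  have wu: "w \<cdot> u = Ident C (Dom C l)"
    using Comp_assoc[OF u(1) w(1) lh] u(2) w(2) Comp_Ident[OF lh]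
    by (intro subobj_cancel[OF l Comp_Hom[OF u(1) w(1)] Ident_Hom[OF L]]) simp
  have pl: "p \<cdot> l = u"
    using bi Comp_assoc[OF u(1) kh p] u Ident_Comp[OF u(1)] by (simp add: is_biproduct_def)
  have "(w \<cdot> p) \<cdot> l = Ident C (Dom C l)"
    using Comp_assoc[OF lh p w(1)] pl wu by simp
  moreover have "(w \<cdot> p) \<cdot> k' = Zero C (Dom C k') (Dom C l)"
    using bi Comp_assoc[OF k'h p w(1)] Comp_Zero[OF w(1)] by (simp add: is_biproduct_def)
  moreover have "p' \<cdot> l = Zero C (Dom C l) (Dom C k')"
    using bi Comp_assoc[OF u(1) kh p'] u(2) Zero_Comp[OF u(1)] by (simp add: is_biproduct_def)
  moreover have "l \<cdot> (w \<cdot> p) = k \<cdot> p"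
    using Comp_assoc[OF p w(1) lh] w(2) by simp
  ultimately have "is_biproduct C (Dom C l) (Dom C k') M l k' (w \<cdot> p) p'"
    using bi lh L Comp_Hom[OF p w(1)] by (simp add: is_biproduct_def)
  then show ?thesis
    using l by (auto simp: direct_summand_def)
qed

text \<open>The family is one morphism \<open>g\<close> into the product of copies of N. By
  uniqueness of factorizations through the product, \<open>g t\<close> vanishes exactly when all
  \<open>f i\<close> kill \<open>t\<close>, so the kernel of \<open>g\<close> is the
  intersection.\<close>

lemma SubInter_Kern:
  assumes ab3: "AB3_star C TYPE('i)" and M: "M \<in> Obj C" and N: "N \<in> Obj C"
    and f: "\<And>i. i \<in> (I :: 'i set) \<Longrightarrow> f i \<in> Hom C M N"
  shows "subobj C M (SubInter C M ((\<lambda>i. Kern C (f i)) ` I))" (is "subobj C M ?L")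
    and "t \<in> Hom C T M \<Longrightarrow>
      sub_le C t (SubInter C M ((\<lambda>i. Kern C (f i)) ` I)) \<longleftrightarrow> (\<forall>i\<in>I. f i \<cdot> t = Zero C T N)"
proof -
  have "\<exists>P \<pi>. is_product C I (\<lambda>_. N) P \<pi>"
    using ab3 N by (simp add: AB3_star_def)
  then obtain P \<pi> where P: "is_product C I (\<lambda>_. N) P \<pi>"
    by blast
  then have \<pi>: "\<And>i. i \<in> I \<Longrightarrow> \<pi> i \<in> Hom C P N" and PO: "P \<in> Obj C"
    by (auto simp: is_product_def)
  have univP: "\<exists>!u. u \<in> Hom C T P \<and> (\<forall>i\<in>I. \<pi> i \<cdot> u = t i)"
    if "T \<in> Obj C" "\<forall>i\<in>I. t i \<in> Hom C T N" for T t
    using P that unfolding is_product_def by blast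
  have "\<exists>!u. u \<in> Hom C M P \<and> (\<forall>i\<in>I. \<pi> i \<cdot> u = f i)"
    using univP[OF M, of f] f by blast
  then obtain g where g: "g \<in> Hom C M P" "\<And>i. i \<in> I \<Longrightarrow> \<pi> i \<cdot> g = f i"
    by blast
  have g_iff: "g \<cdot> t = Zero C T P \<longleftrightarrow> (\<forall>i\<in>I. f i \<cdot> t = Zero C T N)" if t: "t \<in> Hom C T M" for T t
  proof -
    have T: "T \<in> Obj C"
      using Hom_Obj[OF t] by blast
    have eq: "\<pi> i \<cdot> (g \<cdot> t) = f i \<cdot> t" if "i \<in> I" for i
      using Comp_assoc[OF t g(1) \<pi>[OF that]] g(2)[OF that] by simp
    have z: "Zero C T P \<in> Hom C T P" "\<And>i. i \<in> I \<Longrightarrow> \<pi> i \<cdot> Zero C T P = Zero C T N"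
      using Zero_Hom[OF T PO] Comp_Zero[OF \<pi> T] by auto
    have "\<exists>!u. u \<in> Hom C T P \<and> (\<forall>i\<in>I. \<pi> i \<cdot> u = Zero C T N)"
      using univP[OF T, of "\<lambda>_. Zero C T N"] Zero_Hom[OF T N] by blast
    then show ?thesis
      using Comp_Hom[OF t g(1)] eq z by metis
  qed
  have univ: "sub_le C t (Kern C g) \<longleftrightarrow> (\<forall>s\<in>(\<lambda>i. Kern C (f i)) ` I. sub_le C t s)"
    if t: "t \<in> Hom C T M" for T t
    using Kern_le_iff[OF g(1) t] g_iff[OF t] Kern_le_iff[OF f t] by simp
  have sub: "subobj C M s" if "s \<in> (\<lambda>i. Kern C (f i)) ` I" for s
    using that subobj_Kern[OF f] by blast
  note main = SubInter_le_iff[OF subobj_Kern[OF g(1)] sub univ]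
  show "subobj C M ?L"
    by (rule main(1))
  show "sub_le C t ?L \<longleftrightarrow> (\<forall>i\<in>I. f i \<cdot> t = Zero C T N)" if t: "t \<in> Hom C T M"
    using main(2)[OF _ _ t] Kern_le_iff[OF f t] by simp
qed

text \<open>The family is one morphism \<open>h\<close> out of the coproduct of copies of M, and the
  image of \<open>h\<close> is the sum.\<close>

lemma SubSum_Img:
  assumes ab3: "AB3 C TYPE('i)" and M: "M \<in> Obj C" and N: "N \<in> Obj C"
    and f: "\<And>i. i \<in> (I :: 'i set) \<Longrightarrow> f i \<in> Hom C M N"
  shows "subobj C N (SubSum C N ((\<lambda>i. Img C (f i)) ` I))" (is "subobj C N ?L")
    and "g \<in> Hom C N T \<Longrightarrow>
      g \<cdot> SubSum C N ((\<lambda>i. Img C (f i)) ` I) =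
        Zero C (Dom C (SubSum C N ((\<lambda>i. Img C (f i)) ` I))) T \<longleftrightarrow>
      (\<forall>i\<in>I. g \<cdot> f i = Zero C M T)"
proof -
  have "\<exists>S \<iota>. is_coproduct C I (\<lambda>_. M) S \<iota>"
    using ab3 M by (simp add: AB3_def)
  then obtain S \<iota> where S: "is_coproduct C I (\<lambda>_. M) S \<iota>"
    by blast
  then have \<iota>: "\<And>i. i \<in> I \<Longrightarrow> \<iota> i \<in> Hom C M S" and SO: "S \<in> Obj C"
    by (auto simp: is_coproduct_def)
  have univS: "\<exists>!u. u \<in> Hom C S T \<and> (\<forall>i\<in>I. u \<cdot> \<iota> i = t i)"
    if "T \<in> Obj C" "\<forall>i\<in>I. t i \<in> Hom C M T" for T t
    using S that unfolding is_coproduct_def by blast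
  have "\<exists>!u. u \<in> Hom C S N \<and> (\<forall>i\<in>I. u \<cdot> \<iota> i = f i)"
    using univS[OF N, of f] f by blast
  then obtain h where h: "h \<in> Hom C S N" "\<And>i. i \<in> I \<Longrightarrow> h \<cdot> \<iota> i = f i"
    by blast
  have h_iff: "g \<cdot> h = Zero C S T \<longleftrightarrow> (\<forall>i\<in>I. g \<cdot> f i = Zero C M T)" if g: "g \<in> Hom C N T" for T g
  proof -
    have T: "T \<in> Obj C"
      using Hom_Obj[OF g] by blast
    have eq: "(g \<cdot> h) \<cdot> \<iota> i = g \<cdot> f i" if "i \<in> I" for i
      using Comp_assoc[OF \<iota>[OF that] h(1) g] h(2)[OF that] by simp
    have z: "Zero C S T \<in> Hom C S T" "\<And>i. i \<in> I \<Longrightarrow> Zero C S T \<cdot> \<iota> i = Zero C M T"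
      using Zero_Hom[OF SO T] Zero_Comp[OF \<iota> T] by auto
    have "\<exists>!u. u \<in> Hom C S T \<and> (\<forall>i\<in>I. u \<cdot> \<iota> i = Zero C M T)"
      using univS[OF T, of "\<lambda>_. Zero C M T"] Zero_Hom[OF M T] by blast
    then show ?thesis
      using Comp_Hom[OF h(1) g] eq z by metis
  qed
  have univ: "g \<cdot> Img C h = Zero C (Dom C (Img C h)) T \<longleftrightarrow>
      (\<forall>s\<in>(\<lambda>i. Img C (f i)) ` I. g \<cdot> s = Zero C (Dom C s) T)"
    if g: "g \<in> Hom C N T" for T g
    using Comp_Img_Zero_iff[OF h(1) g] h_iff[OF g] Comp_Img_Zero_iff[OF f g] by simp
  have sub: "subobj C N s" if "s \<in> (\<lambda>i. Img C (f i)) ` I" for s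
    using that subobj_Img[OF f] by blast
  note main = SubSum_Zero_iff[OF subobj_Img[OF h(1)] sub univ]
  show "subobj C N ?L"
    by (rule main(1))
  show "g \<cdot> ?L = Zero C (Dom C ?L) T \<longleftrightarrow> (\<forall>i\<in>I. g \<cdot> f i = Zero C M T)" if g: "g \<in> Hom C N T"
    using main(2)[OF _ _ g] Comp_Img_Zero_iff[OF f g] by simp
qed

section \<open>Every subobject is essential in itself and lies above itself\<close>

lemma essential_Ident:
  assumes A: "A \<in> Obj C"
  shows "essential C A (Ident C A)"
proof -
  have "x = Zero C (Dom C x) A"
    if x: "subobj C A x"
      and disj: "\<forall>T. \<forall>t \<in> Hom C T A. sub_le C t (Ident C A) \<and> sub_le C t x \<longrightarrow> t = Zero C T A"
    for x
  proof -
    note xh = subobj_Hom[OF x]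
    have "sub_le C x (Ident C A)"
      using sub_leI[OF Ident_Comp[OF xh] xh Ident_Hom[OF A] xh] .
    then show ?thesis
      using disj xh sub_le_refl[OF xh] by blast
  qed
  then show ?thesis
    unfolding essential_iff using subobj_Ident[OF A] by blast
qed

lemma essential_in_refl:
  assumes "subobj C M l"
  shows "essential_in C l l"
  unfolding essential_in_def
  using Ident_Hom Comp_Ident[OF subobj_Hom[OF assms]] essential_Ident
    Hom_Obj[OF subobj_Hom[OF assms]] by blast

lemma superfluous_Zero:
  assumes a: "subobj C B a" and zero: "a = Zero C (Dom C a) B"
  shows "superfluous C B a"
proof -
  have "g \<cdot> a = Zero C (Dom C a) T" if "g \<in> Hom C B T" for g T
    using Comp_Zero[OF that, of "Dom C a"] zero Hom_Obj[OF subobj_Hom[OF a]] by simp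
  then show ?thesis
    unfolding superfluous_iff using a by blast
qed

text \<open>With \<open>u\<close> the identity, L/L is a zero object: its quotient map is zero,
  hence so is its identity. The induced \<open>v\<close> is therefore the zero morphism, which is
  mono because its domain is zero.\<close>

lemma lies_above_refl:
  assumes l: "subobj C N l"
  shows "lies_above C l l"
proof -
  note lh = subobj_Hom[OF l]
  have L: "Dom C l \<in> Obj C"
    using Hom_Obj[OF lh] by blast
  note i = Ident_Hom[OF L]
  let ?u = "Ident C (Dom C l)"
  let ?q = "Cokern C ?u" and ?r = "Cokern C l"
  note q = Cokern_Hom[OF i] and r = Cokern_Hom[OF lh]
  have Q: "Cod C ?q \<in> Obj C" and R: "Cod C ?r \<in> Obj C"
    using Hom_Obj[OF q] Hom_Obj[OF r] by auto
  let ?v = "Zero C (Cod C ?q) (Cod C ?r)"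
  note v = Zero_Hom[OF Q R]
  have "?q = Zero C (Dom C l) (Cod C ?q)"
    using Cokern_Comp[OF i] Comp_Ident[OF q] by simp
  then have "Ident C (Cod C ?q) = Zero C (Cod C ?q) (Cod C ?q)"
    using Ident_Comp[OF q] by (intro Cokern_cancel_Zero[OF i Ident_Hom[OF Q]]) simp
  then have "t = Zero C T (Cod C ?q)" if "t \<in> Hom C T (Cod C ?q)" for T t
    using Ident_Comp[OF that] Zero_Comp[OF that Q] by simp
  then have "subobj C (Cod C ?r) ?v"
    by (rule subobjI_Zero[OF v])
  then have "superfluous C (Cod C ?r) ?v"
    using superfluous_Zero Hom_Dom[OF v] by simp
  moreover have "?v \<cdot> ?q = ?r \<cdot> l"
    using Zero_Comp[OF q R] Cokern_Comp[OF lh] by simp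
  ultimately show ?thesis
    using i v Comp_Ident[OF lh] unfolding lies_above_def by blast
qed

section \<open>Direct summands and nonsingularity\<close>

lemma direct_summandE:
  assumes "direct_summand C M k"
  obtains k' K' p p' where "k \<in> Hom C (Dom C k) M" "k' \<in> Hom C K' M"
    "p \<in> Hom C M (Dom C k)" "p' \<in> Hom C M K'"
    "p \<cdot> k = Ident C (Dom C k)" "p' \<cdot> k' = Ident C K'"
    "p \<cdot> k' = Zero C K' (Dom C k)" "p' \<cdot> k = Zero C (Dom C k) K'"
    "(k \<cdot> p) \<oplus>\<^sub>h (k' \<cdot> p') = Ident C M"
proof -
  obtain k' p p' where "is_biproduct C (Dom C k) (Dom C k') M k k' p p'"
    using assms by (auto simp: direct_summand_def)
  then show ?thesis
    unfolding is_biproduct_def by (intro that[of k' "Dom C k'" p p']) blast+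
qed

text \<open>Expanding \<open>g\<close> along the decomposition of the identity leaves only the part
  through the complement.\<close>

lemma Comp_biproduct_Zero:
  assumes k: "k \<in> Hom C K M" and k': "k' \<in> Hom C K' M"
    and p: "p \<in> Hom C M K" and p': "p' \<in> Hom C M K'"
    and id: "(k \<cdot> p) \<oplus>\<^sub>h (k' \<cdot> p') = Ident C M"
    and g: "g \<in> Hom C M T" and gk: "g \<cdot> k = Zero C K T"
  shows "g = (g \<cdot> k') \<cdot> p'"
proof -
  have T: "T \<in> Obj C"
    using Hom_Obj[OF g] by blast
  have "g = g \<cdot> ((k \<cdot> p) \<oplus>\<^sub>h (k' \<cdot> p'))"
    using Comp_Ident[OF g] id by simp
  also have "\<dots> = (g \<cdot> (k \<cdot> p)) \<oplus>\<^sub>h (g \<cdot> (k' \<cdot> p'))"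
    by (rule Comp_Add_right[OF Comp_Hom[OF p k] Comp_Hom[OF p' k'] g])
  also have "\<dots> = ((g \<cdot> k) \<cdot> p) \<oplus>\<^sub>h ((g \<cdot> k') \<cdot> p')"
    using Comp_assoc[OF p k g] Comp_assoc[OF p' k' g] by simp
  also have "\<dots> = (g \<cdot> k') \<cdot> p'"
    using gk Zero_Comp[OF p T] Zero_Add[OF Comp_Hom[OF p' Comp_Hom[OF k' g]]] by simp
  finally show ?thesis .
qed

lemma subobj_Zero_cancel:
  assumes m: "subobj C M m" and t: "t \<in> Hom C T (Dom C m)" and zero: "m \<cdot> t = Zero C T M"
  shows "t = Zero C T (Dom C m)"
proof (rule subobj_cancel[OF m t])
  show "Zero C T (Dom C m) \<in> Hom C T (Dom C m)"
    using Zero_Hom Hom_Obj[OF t] by blast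
  show "m \<cdot> t = m \<cdot> Zero C T (Dom C m)"
    using zero Comp_Zero[OF subobj_Hom[OF m], of T] Hom_Obj[OF t] by simp
qed

text \<open>
  With \<open>p\<close> the projection onto the summand \<open>k\<close>, the kernel of \<open>f k p\<close> is essential in \<open>M\<close>, being
  the preimage under \<open>p\<close> of a kernel that contains \<open>l\<close>; so \<open>f k p = 0\<close>.
\<close>

lemma K_nonsingular_vanishes:
  assumes K: "K_nonsingular C M N" and k: "direct_summand C M k"
    and ess: "essential_in C l k" and f: "f \<in> Hom C M N" and fl: "f \<cdot> l = Zero C (Dom C l) N"
  shows "f \<cdot> k = Zero C (Dom C k) N"
proof -
  obtain p where kh: "k \<in> Hom C (Dom C k) M" and p: "p \<in> Hom C M (Dom C k)"
    and pk: "p \<cdot> k = Ident C (Dom C k)"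
    using k by (blast elim: direct_summandE)
  obtain u where u: "u \<in> Hom C (Dom C l) (Dom C k)" "k \<cdot> u = l"
    and ess_u: "essential C (Dom C k) u"
    using ess by (auto simp: essential_in_def)
  have N: "N \<in> Obj C" and KO: "Dom C k \<in> Obj C"
    using Hom_Obj[OF f] Hom_Obj[OF kh] by auto
  note fk = Comp_Hom[OF kh f]
  let ?g = "(f \<cdot> k) \<cdot> p"
  note g = Comp_Hom[OF p fk]
  have "x = Zero C (Dom C x) M"
    if x: "subobj C M x"
      and disj: "\<forall>T. \<forall>t \<in> Hom C T M. sub_le C t (Kern C ?g) \<and> sub_le C t x \<longrightarrow> t = Zero C T M"
    for x
  proof -
    note xh = subobj_Hom[OF x]
    note px = Comp_Hom[OF xh p]
    \<comment> \<open>If \<open>f k\<close> kills \<open>p x b\<close>, then \<open>x b\<close>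
      factors through both \<open>x\<close> and the kernel of \<open>?g\<close>, so
      \<open>disj\<close> applies.\<close>
    have vanish: "x \<cdot> b = Zero C T M"
      if b: "b \<in> Hom C T (Dom C x)" and zero: "(f \<cdot> k) \<cdot> ((p \<cdot> x) \<cdot> b) = Zero C T N" for b T
    proof -
      note xb = Comp_Hom[OF b xh]
      have "?g \<cdot> (x \<cdot> b) = Zero C T N"
        using zero Comp_assoc[OF xb p fk] Comp_assoc[OF b xh p] by simp
      then show ?thesis
        using disj xb Kern_le_iff[OF g xb] sub_le_Comp[OF xh b] by blast
    qed
    \<comment> \<open>\<open>x\<close> meets the kernel of \<open>?g\<close>, hence that of
      \<open>p\<close>, only in zero. So \<open>p x\<close> is again mono, a subobject of K against
      which the essential \<open>u\<close> can be tested.\<close>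
    have "subobj C (Dom C k) (p \<cdot> x)"
    proof (rule subobjI_Zero[OF px])
      fix T t
      assume t: "t \<in> Hom C T (Dom C x)" and zero: "(p \<cdot> x) \<cdot> t = Zero C T (Dom C k)"
      have "(f \<cdot> k) \<cdot> ((p \<cdot> x) \<cdot> t) = Zero C T N"
        using zero Comp_Zero[OF fk, of T] Hom_Obj[OF t] by simp
      then show "t = Zero C T (Dom C x)"
        by (rule subobj_Zero_cancel[OF x t vanish[OF t]])
    qed
    \<comment> \<open>\<open>t\<close> comes from L, where \<open>f\<close> vanishes, so
      \<open>f k\<close> kills \<open>t = p x b\<close>; now \<open>vanish\<close> gives
      \<open>x b = 0\<close>.\<close>
    moreover have "t = Zero C T (Dom C k)"
      if t: "t \<in> Hom C T (Dom C k)" and tu: "sub_le C t u" and tpx: "sub_le C t (p \<cdot> x)" for T t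
    proof -
      obtain a where a: "a \<in> Hom C T (Dom C l)" "u \<cdot> a = t"
        using sub_leE[OF tu t u(1)] .
      obtain b where b: "b \<in> Hom C T (Dom C x)" "(p \<cdot> x) \<cdot> b = t"
        using sub_leE[OF tpx t px] .
      have "(f \<cdot> k) \<cdot> t = (f \<cdot> l) \<cdot> a"
        using Comp_assoc[OF a(1) u(1) fk] Comp_assoc[OF u(1) kh f] a(2) u(2) by simp
      then have "(f \<cdot> k) \<cdot> t = Zero C T N"
        using fl Zero_Comp[OF a(1) N] by simp
      then have "x \<cdot> b = Zero C T M"
        using b(2) by (intro vanish[OF b(1)]) simp
      then show ?thesis
        using Comp_assoc[OF b(1) xh p] b(2) Comp_Zero[OF p, of T] Hom_Obj[OF t] by simp
    qed
    \<comment> \<open>With \<open>p x = 0\<close>, \<open>x\<close> itself factors through the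
      kernel of \<open>?g\<close>, and \<open>disj\<close> makes it zero.\<close>
    ultimately have "p \<cdot> x = Zero C (Dom C (p \<cdot> x)) (Dom C k)"
      using ess_u unfolding essential_iff by blast
    then have "p \<cdot> x = Zero C (Dom C x) (Dom C k)"
      using Hom_Dom[OF px] by simp
    then have "?g \<cdot> x = Zero C (Dom C x) N"
      using Comp_assoc[OF xh p fk] Comp_Zero[OF fk, of "Dom C x"] Hom_Obj[OF xh] by simp
    then show ?thesis
      using disj xh Kern_le_iff[OF g xh] sub_le_refl[OF xh] by blast
  qed
  then have "essential C M (Kern C ?g)"
    unfolding essential_iff using subobj_Kern[OF g] by blast
  then have "?g = Zero C M N"
    using K g by (simp add: K_nonsingular_def)
  then show ?thesis
    using Comp_assoc[OF kh p fk] pk Comp_Ident[OF fk] Zero_Comp[OF kh N] by simp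
qed

lemma K_nonsingular_sub_eq:
  assumes K: "K_nonsingular C M N" and k: "direct_summand C M k"
    and l: "subobj C M l" and ess: "essential_in C l k"
    and f: "\<And>i. i \<in> I \<Longrightarrow> f i \<in> Hom C M N"
    and iff: "\<And>T t. t \<in> Hom C T M \<Longrightarrow> sub_le C t l \<longleftrightarrow> (\<forall>i\<in>I. f i \<cdot> t = Zero C T N)"
  shows "sub_eq C k l"
proof -
  have kh: "k \<in> Hom C (Dom C k) M"
    using k by (rule direct_summandE)
  note lh = subobj_Hom[OF l]
  have "f i \<cdot> k = Zero C (Dom C k) N" if "i \<in> I" for i
    using iff[OF lh] sub_le_refl[OF lh] that
    by (intro K_nonsingular_vanishes[OF K k ess f[OF that]]) blast
  then have "sub_le C k l"
    using iff[OF kh] by blast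
  moreover have "sub_le C l k"
    using ess by (auto simp: essential_in_def sub_le_def)
  ultimately show ?thesis
    by (simp add: sub_eq_def)
qed

lemma essential_direct_summand_vanishes:
  assumes k: "direct_summand C M k" and ess: "essential C M k"
    and g: "g \<in> Hom C M N" and gk: "g \<cdot> k = Zero C (Dom C k) N"
  shows "g = Zero C M N"
proof -
  obtain k' K' p p' where kh: "k \<in> Hom C (Dom C k) M" and k'h: "k' \<in> Hom C K' M"
    and p: "p \<in> Hom C M (Dom C k)" and p': "p' \<in> Hom C M K'"
    and p'k': "p' \<cdot> k' = Ident C K'" and p'k: "p' \<cdot> k = Zero C (Dom C k) K'"
    and id: "(k \<cdot> p) \<oplus>\<^sub>h (k' \<cdot> p') = Ident C M"
    using k by (rule direct_summandE)
  have K': "K' \<in> Obj C" and N: "N \<in> Obj C"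
    using Hom_Obj[OF k'h] Hom_Obj[OF g] by auto
  have "t = Zero C T M"
    if t: "t \<in> Hom C T M" and tk: "sub_le C t k" and tk': "sub_le C t k'" for T t
  proof -
    obtain a where a: "a \<in> Hom C T (Dom C k)" "k \<cdot> a = t"
      using sub_leE[OF tk t kh] .
    obtain b where b: "b \<in> Hom C T K'" "k' \<cdot> b = t"
      using sub_leE[OF tk' t k'h] .
    have "p' \<cdot> t = Zero C T K'"
      using Comp_assoc[OF a(1) kh p'] a(2) p'k Zero_Comp[OF a(1) K'] by simp
    moreover have "p' \<cdot> t = b"
      using Comp_assoc[OF b(1) k'h p'] b(2) p'k' Ident_Comp[OF b(1)] by simp
    ultimately show ?thesis
      using b(2) Comp_Zero[OF k'h, of T] Hom_Obj[OF t] by simp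
  qed
  then have "k' = Zero C (Dom C k') M"
    using ess subobj_split[OF k'h p' p'k'] unfolding essential_iff by blast
  then have "k' = Zero C K' M"
    using Hom_Dom[OF k'h] by simp
  then have "g \<cdot> k' = Zero C K' N"
    using Comp_Zero[OF g K'] by simp
  then show ?thesis
    using Comp_biproduct_Zero[OF kh k'h p p' id g gk] Zero_Comp[OF p' N] by simp
qed

text \<open>
  With \<open>p'\<close> and \<open>k'\<close> the projection onto and the inclusion of a complement of \<open>k\<close>, the image of
  \<open>k' p' f\<close> is superfluous in \<open>N\<close>: under \<open>K' \<cong> N/K\<close> the image of \<open>p' f\<close> lies in \<open>L/K\<close>.
  Sums of subobjects are handled through the morphisms that vanish on them.  For \<open>X \<subseteq> N\<close> with
  \<open>Im (k' p' f) + X = N\<close> the composite \<open>?r : N/K \<rightarrow> N/X\<close> is epi, and its kernel together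
  with \<open>L/K\<close> generates \<open>N/K\<close>; hence \<open>?r = 0\<close> and \<open>N/X = 0\<close>.
\<close>

lemma T_nonsingular_vanishes:
  assumes T: "T_nonsingular C M N" and k: "direct_summand C N k"
    and l: "subobj C N l" and above: "lies_above C l k"
    and f: "f \<in> Hom C M N" and fl: "sub_le C f l"
    and g: "g \<in> Hom C N D" and gk: "g \<cdot> k = Zero C (Dom C k) D"
  shows "g \<cdot> f = Zero C M D"
proof -
  note lh = subobj_Hom[OF l]
  obtain k' K' p p' where kh: "k \<in> Hom C (Dom C k) N" and k'h: "k' \<in> Hom C K' N"
    and p: "p \<in> Hom C N (Dom C k)" and p': "p' \<in> Hom C N K'"
    and p'k': "p' \<cdot> k' = Ident C K'" and p'k: "p' \<cdot> k = Zero C (Dom C k) K'"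
    and id: "(k \<cdot> p) \<oplus>\<^sub>h (k' \<cdot> p') = Ident C N"
    using k by (rule direct_summandE)
  let ?q = "Cokern C k"
  let ?Q = "Cod C ?q"
  note q = Cokern_Hom[OF kh]
  obtain u v where u: "u \<in> Hom C (Dom C k) (Dom C l)" and v: "v \<in> Hom C (Cod C (Cokern C u)) ?Q"
    and vu: "v \<cdot> Cokern C u = ?q \<cdot> l" and sup: "superfluous C ?Q v"
    using above by (auto simp: lies_above_def)
  note cu = Cokern_Hom[OF u]
  obtain s where s: "s \<in> Hom C ?Q K'" "s \<cdot> ?q = p'"
    using Cokern_factor_iff[OF kh p'] p'k by blast
  obtain e where e: "e \<in> Hom C M (Dom C l)" "l \<cdot> e = f"
    using sub_leE[OF fl f lh] .
  note p'f = Comp_Hom[OF f p']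
  let ?h = "k' \<cdot> (p' \<cdot> f)"
  note h = Comp_Hom[OF p'f k'h]
  have MO: "M \<in> Obj C" and NO: "N \<in> Obj C"
    using Hom_Obj[OF f] by auto
  \<comment> \<open>\<open>joint\<close> expresses that the image of \<open>?h\<close> and
    \<open>x\<close> generate N. The \<open>g\<close> here is a fresh test morphism, not the one of
    the lemma.\<close>
  have "g = Zero C N T"
    if x: "subobj C N x"
      and joint: "\<forall>T. \<forall>g \<in> Hom C N T. g \<cdot> Img C ?h = Zero C (Dom C (Img C ?h)) T \<and>
        g \<cdot> x = Zero C (Dom C x) T \<longrightarrow> g = Zero C N T"
      and g: "g \<in> Hom C N T" and gx: "g \<cdot> x = Zero C (Dom C x) T"
    for x g T
  proof -
    note xh = subobj_Hom[OF x]
    let ?y = "Cokern C x"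
    let ?Y = "Cod C ?y"
    note y = Cokern_Hom[OF xh]
    let ?z = "?y \<cdot> k'"
    note z = Comp_Hom[OF k'h y]
    have YO: "?Y \<in> Obj C" and QO: "?Q \<in> Obj C" and XO: "Dom C x \<in> Obj C"
      using Hom_Obj[OF y] Hom_Obj[OF q] Hom_Obj[OF xh] by auto
    \<comment> \<open>\<open>joint\<close> read on N/X: \<open>w\<close> after \<open>?y\<close>
      always kills \<open>x\<close>, so it suffices that it also kills \<open>?h\<close>.\<close>
    have cancel: "w = Zero C ?Y R"
      if w: "w \<in> Hom C ?Y R" and zero: "(w \<cdot> ?z) \<cdot> (p' \<cdot> f) = Zero C M R" for w R
    proof -
      note wy = Comp_Hom[OF y w]
      have "(w \<cdot> ?y) \<cdot> ?h = Zero C M R"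
        using Comp_assoc[OF p'f k'h wy] Comp_assoc[OF k'h y w] zero by simp
      then have "(w \<cdot> ?y) \<cdot> Img C ?h = Zero C (Dom C (Img C ?h)) R"
        using Comp_Img_Zero_iff[OF h wy] by blast
      moreover have "(w \<cdot> ?y) \<cdot> x = Zero C (Dom C x) R"
        using Comp_assoc[OF xh y w] Cokern_Comp[OF xh] Comp_Zero[OF w XO] by simp
      ultimately have "w \<cdot> ?y = Zero C N R"
        using joint wy by blast
      then show ?thesis
        by (rule Cokern_cancel_Zero[OF xh w])
    qed
    have cancel_z: "w = Zero C ?Y R"
      if w: "w \<in> Hom C ?Y R" and zero: "w \<cdot> ?z = Zero C K' R" for w R
      using zero Zero_Comp[OF p'f, of R] Hom_Obj[OF w] by (intro cancel[OF w]) simp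
    \<comment> \<open>\<open>?r\<close> runs N/K -> K' -> N -> N/X. It is epi because
      \<open>?z\<close> is epi by \<open>cancel_z\<close>, and \<open>p'\<close>, which factors as
      \<open>s\<close> after \<open>?q\<close>, is split by \<open>k'\<close>.\<close>
    let ?r = "?z \<cdot> s"
    note r = Comp_Hom[OF s(1) z]
    have r_Zero: "w \<cdot> ?z = Zero C K' R"
      if w: "w \<in> Hom C ?Y R" and zero: "w \<cdot> ?r = Zero C ?Q R" for w R
    proof -
      note wz = Comp_Hom[OF z w]
      have R: "R \<in> Obj C"
        using Hom_Obj[OF w] by blast
      have "(w \<cdot> ?z) \<cdot> s = Zero C ?Q R"
        using Comp_assoc[OF s(1) z w] zero by simp
      then have "(w \<cdot> ?z) \<cdot> p' = Zero C N R"
        using Comp_assoc[OF q s(1) wz] s(2) Zero_Comp[OF q R] by simp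
      then show ?thesis
        using Comp_assoc[OF k'h p' wz] p'k' Comp_Ident[OF wz] Zero_Comp[OF k'h R] by simp
    qed
    have "is_epi C ?r"
      using r_Zero cancel_z by (intro is_epiI_Zero[OF r]) blast
    \<comment> \<open>As an epi is a cokernel, the image of \<open>c\<close> can stand for the
      kernel of \<open>?r\<close>: whatever kills it factors through \<open>?r\<close>.\<close>
    then obtain c where c: "is_cokernel C c ?r"
      using epi_is_cokernel by blast
    then have ch: "c \<in> Hom C (Dom C c) ?Q" and rc: "?r \<cdot> c = Zero C (Dom C c) ?Y"
      using Hom_Dom[OF r] Hom_Cod[OF r] by (auto simp: is_cokernel_def Hom_def)
    \<comment> \<open>The image of \<open>c\<close> and L/K generate N/K: write \<open>a\<close> as
      \<open>w\<close> after \<open>?r\<close>. Since \<open>a\<close> kills L/K, its composite with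
      \<open>?q\<close> kills \<open>l\<close> and hence \<open>f = l e\<close>; this composite at
      \<open>f\<close> is \<open>w ?z p' f\<close>, so \<open>cancel\<close> gives
      \<open>w = 0\<close>.\<close>
    have "a = Zero C ?Q R"
      if a: "a \<in> Hom C ?Q R" and av: "a \<cdot> v = Zero C (Dom C v) R"
        and ac: "a \<cdot> Img C c = Zero C (Dom C (Img C c)) R" for a R
    proof -
      have R: "R \<in> Obj C"
        using Hom_Obj[OF a] by blast
      have "a \<cdot> c = Zero C (Dom C c) R"
        using ac Comp_Img_Zero_iff[OF ch a] by blast
      then have "\<exists>w \<in> Hom C (Cod C ?r) R. w \<cdot> ?r = a"
        using is_cokernel_iff[OF c ch a] by blast
      then obtain w where w: "w \<in> Hom C ?Y R" "w \<cdot> ?r = a"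
        using Hom_Cod[OF r] by auto
      note wz = Comp_Hom[OF z w(1)]
      have "a \<cdot> ?q = (w \<cdot> ?z) \<cdot> p'"
        using Comp_assoc[OF s(1) z w(1)] Comp_assoc[OF q s(1) wz] w(2) s(2) by simp
      then have "(w \<cdot> ?z) \<cdot> (p' \<cdot> f) = (a \<cdot> ?q) \<cdot> f"
        using Comp_assoc[OF f p' wz] by simp
      also have "\<dots> = ((a \<cdot> ?q) \<cdot> l) \<cdot> e"
        using Comp_assoc[OF e(1) lh Comp_Hom[OF q a]] e(2) by simp
      also have "(a \<cdot> ?q) \<cdot> l = (a \<cdot> v) \<cdot> Cokern C u"
        using Comp_assoc[OF lh q a] Comp_assoc[OF cu v a] vu by simp
      also have "\<dots> = Zero C (Dom C l) R"
        using av Hom_Dom[OF v] Zero_Comp[OF cu R] by simp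
      finally have "(w \<cdot> ?z) \<cdot> (p' \<cdot> f) = Zero C M R"
        using Zero_Comp[OF e(1) R] by simp
      then have "w = Zero C ?Y R"
        by (rule cancel[OF w(1)])
      then show ?thesis
        using w(2) Zero_Comp[OF r R] by simp
    qed
    then have "\<forall>R. \<forall>a \<in> Hom C ?Q R. a \<cdot> Img C c = Zero C (Dom C (Img C c)) R \<longrightarrow> a = Zero C ?Q R"
      using sup subobj_Img[OF ch] unfolding superfluous_iff by blast
    then have "?r = Zero C ?Q ?Y"
      using r rc Comp_Img_Zero_iff[OF ch r] by blast
    then have "Ident C ?Y \<cdot> ?z = Zero C K' ?Y"
      using Ident_Comp[OF r] by (intro r_Zero[OF Ident_Hom[OF YO]]) simp
    then have "Ident C ?Y = Zero C ?Y ?Y"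
      by (rule cancel_z[OF Ident_Hom[OF YO]])
    then have "?y = Zero C N ?Y"
      using Ident_Comp[OF y] Zero_Comp[OF y YO] by simp
    moreover obtain b where b: "b \<in> Hom C ?Y T" "b \<cdot> ?y = g"
      using Cokern_factor_iff[OF xh g] gx by blast
    ultimately show ?thesis
      using Comp_Zero[OF b(1) NO] by simp
  qed
  then have "superfluous C N (Img C ?h)"
    unfolding superfluous_iff using subobj_Img[OF h] by blast
  then have "?h = Zero C M N"
    using T h by (simp add: T_nonsingular_def)
  then have "p' \<cdot> f = Zero C M K'"
    using Comp_assoc[OF p'f k'h p'] p'k' Ident_Comp[OF p'f] Comp_Zero[OF p' MO] by simp
  then show ?thesis
    using Comp_biproduct_Zero[OF kh k'h p p' id g gk] Comp_assoc[OF f p' Comp_Hom[OF k'h g]]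
      Comp_Zero[OF Comp_Hom[OF k'h g] MO] by simp
qed

text \<open>\<open>l\<close> is compared with \<open>k\<close> by means of the morphisms that vanish
  on \<open>k\<close>: each of them kills every \<open>f i\<close>, and hence
  \<open>l\<close>.\<close>

lemma T_nonsingular_sub_eq:
  assumes T: "T_nonsingular C M N" and k: "direct_summand C N k"
    and l: "subobj C N l" and above: "lies_above C l k"
    and f: "\<And>i. i \<in> I \<Longrightarrow> f i \<in> Hom C M N"
    and iff: "\<And>T g. g \<in> Hom C N T \<Longrightarrow>
      g \<cdot> l = Zero C (Dom C l) T \<longleftrightarrow> (\<forall>i\<in>I. g \<cdot> f i = Zero C M T)"
  shows "sub_eq C k l"
proof -
  have sub: "subobj C N k"
    using k by (simp add: direct_summand_def)
  note lh = subobj_Hom[OF l]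
  have fl: "sub_le C (f i) l" if "i \<in> I" for i
    using iff that sub_le_iff_Zero[OF l f[OF that]] by blast
  have "g \<cdot> f i = Zero C M D"
    if "i \<in> I" "g \<in> Hom C N D" "g \<cdot> k = Zero C (Dom C k) D" for i g D
    using T_nonsingular_vanishes[OF T k l above f fl] that by blast
  then have "sub_le C l k"
    using iff sub_le_iff_Zero[OF sub lh] by blast
  moreover have "sub_le C k l"
    using above by (auto simp: lies_above_def sub_le_def)
  ultimately show ?thesis
    by (simp add: sub_eq_def)
qed

text \<open>\<open>k\<close> and its complement \<open>k'\<close> are jointly epi, so superfluity
  makes \<open>k'\<close> epi. From \<open>p k' = 0\<close> follows \<open>p = 0\<close>, and then
  the identity of K is zero.\<close>

lemma superfluous_direct_summand_Zero:
  assumes k: "direct_summand C N k" and sup: "superfluous C N k"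
  shows "k = Zero C (Dom C k) N"
proof -
  obtain k' K' p p' where kh: "k \<in> Hom C (Dom C k) N" and k'h: "k' \<in> Hom C K' N"
    and p: "p \<in> Hom C N (Dom C k)" and p': "p' \<in> Hom C N K'"
    and pk: "p \<cdot> k = Ident C (Dom C k)" and p'k': "p' \<cdot> k' = Ident C K'"
    and pk': "p \<cdot> k' = Zero C K' (Dom C k)"
    and id: "(k \<cdot> p) \<oplus>\<^sub>h (k' \<cdot> p') = Ident C N"
    using k by (rule direct_summandE)
  have K: "Dom C k \<in> Obj C"
    using Hom_Obj[OF kh] by blast
  have dom: "Dom C k' = K'"
    by (rule Hom_Dom[OF k'h])
  have "g = Zero C N T"
    if g: "g \<in> Hom C N T" and "g \<cdot> k = Zero C (Dom C k) T" "g \<cdot> k' = Zero C K' T" for g T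
    using Comp_biproduct_Zero[OF kh k'h p p' id g] that(2,3) Zero_Comp[OF p', of T] Hom_Obj[OF g]
    by simp
  then have "\<forall>T. \<forall>g \<in> Hom C N T. g \<cdot> k' = Zero C K' T \<longrightarrow> g = Zero C N T"
    using sup subobj_split[OF k'h p' p'k'] unfolding superfluous_iff dom[symmetric] by blast
  then have "p = Zero C N (Dom C k)"
    using p pk' by blast
  then have "Ident C (Dom C k) = Zero C (Dom C k) (Dom C k)"
    using pk Zero_Comp[OF kh K] by simp
  then show ?thesis
    using Comp_Ident[OF kh] Comp_Zero[OF kh K] by simp
qed

section \<open>From the Baer conditions to nonsingularity, and the equivalences\<close>

lemma baer_imp_K_nonsingular:
  assumes ab3: "AB3_star C TYPE('i)" and M: "M \<in> Obj C" and N: "N \<in> Obj C"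
    and B: "baer C TYPE('i) M N"
  shows "K_nonsingular C M N"
  unfolding K_nonsingular_def
proof (intro ballI impI)
  fix f
  assume f: "f \<in> Hom C M N" and ess: "essential C M (Kern C f)"
  \<comment> \<open>A single \<open>f\<close> enters the Baer condition as a constant family over
    \<open>UNIV\<close>. This family is nonempty because every HOL type is inhabited, so its
    intersection is \<open>Kern C f\<close> up to \<open>sub_eq\<close>.\<close>
  let ?L = "SubInter C M ((\<lambda>_. Kern C f) ` (UNIV :: 'i set))"
  note L = SubInter_Kern[OF ab3 M N, of UNIV "\<lambda>_. f", OF f]
  have L_iff: "sub_le C t ?L \<longleftrightarrow> f \<cdot> t = Zero C T N" if "t \<in> Hom C T M" for T t
    using L(2)[OF that] by simp
  note kh = subobj_Hom[OF subobj_Kern[OF f]] and lh = subobj_Hom[OF L(1)]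
  have fk: "f \<cdot> Kern C f = Zero C (Dom C (Kern C f)) N"
    using Kern_le_iff[OF f kh] sub_le_refl[OF kh] by blast
  have "sub_eq C ?L (Kern C f)"
    using L_iff[OF lh] L_iff[OF kh] Kern_le_iff[OF f lh] fk sub_le_refl[OF lh]
    by (simp add: sub_eq_def)
  moreover have "direct_summand C M ?L"
    using B[unfolded baer_def, rule_format, of UNIV "\<lambda>_. f"] f by simp
  ultimately have "direct_summand C M (Kern C f)"
    using direct_summand_cong[OF _ subobj_Kern[OF f]] by blast
  then show "f = Zero C M N"
    by (rule essential_direct_summand_vanishes[OF _ ess f fk])
qed

lemma dual_baer_imp_T_nonsingular:
  assumes ab3: "AB3 C TYPE('i)" and M: "M \<in> Obj C" and N: "N \<in> Obj C"
    and B: "dual_baer C TYPE('i) M N"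
  shows "T_nonsingular C M N"
  unfolding T_nonsingular_def
proof (intro ballI impI)
  fix f
  assume f: "f \<in> Hom C M N" and sup: "superfluous C N (Img C f)"
  let ?i = "Img C f"
  let ?L = "SubSum C N ((\<lambda>_. ?i) ` (UNIV :: 'i set))"
  note i = subobj_Img[OF f]
  note L = SubSum_Img[OF ab3 M N, of UNIV "\<lambda>_. f", OF f]
  note ih = subobj_Hom[OF i] and lh = subobj_Hom[OF L(1)]
  have L_iff: "g \<cdot> ?L = Zero C (Dom C ?L) T \<longleftrightarrow> g \<cdot> ?i = Zero C (Dom C ?i) T"
    if "g \<in> Hom C N T" for T g
    using L(2)[OF that] Comp_Img_Zero_iff[OF f that] by simp
  have "sub_eq C ?L ?i"
    unfolding sub_eq_def using sub_le_iff_Zero[OF L(1) ih] sub_le_iff_Zero[OF i lh] L_iff by blast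
  moreover have "direct_summand C N ?L"
    using B[unfolded dual_baer_def, rule_format, of UNIV "\<lambda>_. f"] f by simp
  ultimately have "direct_summand C N ?i"
    using direct_summand_cong[OF _ i] by blast
  then have "?i = Zero C (Dom C ?i) N"
    by (rule superfluous_direct_summand_Zero[OF _ sup])
  then have "Ident C N \<cdot> ?i = Zero C (Dom C ?i) N"
    using Ident_Comp[OF ih] by simp
  then show "f = Zero C M N"
    using Comp_Img_Zero_iff[OF f Ident_Hom[OF N]] Ident_Comp[OF f] by simp
qed

lemma SubInter_Kern_sub_eq:
  assumes ab3: "AB3_star C TYPE('i)" and M: "M \<in> Obj C" and N: "N \<in> Obj C"
    and K: "K_nonsingular C M N"
    and f: "\<forall>i \<in> (I :: 'i set). f i \<in> Hom C M N" and k: "direct_summand C M k"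
    and ess: "essential_in C (SubInter C M ((\<lambda>i. Kern C (f i)) ` I)) k"
  shows "sub_eq C k (SubInter C M ((\<lambda>i. Kern C (f i)) ` I))"
proof -
  have f': "\<And>i. i \<in> I \<Longrightarrow> f i \<in> Hom C M N"
    using f by blast
  note L = SubInter_Kern[OF ab3 M N f']
  show ?thesis
    by (rule K_nonsingular_sub_eq[OF K k L(1) ess f' L(2)])
qed

lemma SubSum_Img_sub_eq:
  assumes ab3: "AB3 C TYPE('i)" and M: "M \<in> Obj C" and N: "N \<in> Obj C"
    and T: "T_nonsingular C M N"
    and f: "\<forall>i \<in> (I :: 'i set). f i \<in> Hom C M N" and k: "direct_summand C N k"
    and above: "lies_above C (SubSum C N ((\<lambda>i. Img C (f i)) ` I)) k"
  shows "sub_eq C k (SubSum C N ((\<lambda>i. Img C (f i)) ` I))"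
proof -
  have f': "\<And>i. i \<in> I \<Longrightarrow> f i \<in> Hom C M N"
    using f by blast
  note L = SubSum_Img[OF ab3 M N f']
  show ?thesis
    by (rule T_nonsingular_sub_eq[OF T k L(1) above f' L(2)])
qed

text \<open>Forwards, the summand \<open>k\<close> of the CS condition is \<open>sub_eq\<close> to
  the chosen intersection, which inherits its properties. Backwards, the intersection serves as its
  own summand, being essential in itself.\<close>

lemma cs_baer_iff_baer:
  assumes ab3: "AB3_star C TYPE('i)" and M: "M \<in> Obj C" and N: "N \<in> Obj C"
  shows "cs_baer C TYPE('i) M N \<and> K_nonsingular C M N \<longleftrightarrow> baer C TYPE('i) M N"
    and "strongly_cs_baer C TYPE('i) M N \<and> K_nonsingular C M N \<longleftrightarrow> strongly_baer C TYPE('i) M N"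
proof -
  have L: "subobj C M (SubInter C M ((\<lambda>i. Kern C (f i)) ` I))"
    if "\<forall>i \<in> (I :: 'i set). f i \<in> Hom C M N" for I f
    using SubInter_Kern(1)[OF ab3 M N] that by blast
  note cong = SubInter_Kern_sub_eq[OF ab3 M N]
  show "cs_baer C TYPE('i) M N \<and> K_nonsingular C M N \<longleftrightarrow> baer C TYPE('i) M N"
  proof (intro iffI conjI)
    assume *: "cs_baer C TYPE('i) M N \<and> K_nonsingular C M N"
    show "baer C TYPE('i) M N"
      unfolding baer_def
    proof (intro allI impI)
      fix I :: "'i set" and f
      assume f: "\<forall>i\<in>I. f i \<in> Hom C M N"
      then obtain k where k: "direct_summand C M k"
        "essential_in C (SubInter C M ((\<lambda>i. Kern C (f i)) ` I)) k"
        using * unfolding cs_baer_def by blast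
      show "direct_summand C M (SubInter C M ((\<lambda>i. Kern C (f i)) ` I))"
        using direct_summand_cong[OF k(1) L[OF f] cong[OF conjunct2[OF *] f k]] .
    qed
  next
    assume *: "baer C TYPE('i) M N"
    then show "K_nonsingular C M N"
      by (rule baer_imp_K_nonsingular[OF ab3 M N])
    show "cs_baer C TYPE('i) M N"
      using * L essential_in_refl unfolding cs_baer_def baer_def by blast
  qed
  show "strongly_cs_baer C TYPE('i) M N \<and> K_nonsingular C M N \<longleftrightarrow> strongly_baer C TYPE('i) M N"
  proof (intro iffI conjI)
    assume *: "strongly_cs_baer C TYPE('i) M N \<and> K_nonsingular C M N"
    show "strongly_baer C TYPE('i) M N"
      unfolding strongly_baer_def
    proof (intro allI impI)
      fix I :: "'i set" and f
      assume f: "\<forall>i\<in>I. f i \<in> Hom C M N"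
      then obtain k where k: "direct_summand C M k"
        "essential_in C (SubInter C M ((\<lambda>i. Kern C (f i)) ` I)) k" "fully_invariant C M k"
        using * unfolding strongly_cs_baer_def by blast
      note eq = cong[OF conjunct2[OF *] f k(1,2)]
      show "direct_summand C M (SubInter C M ((\<lambda>i. Kern C (f i)) ` I)) \<and>
          fully_invariant C M (SubInter C M ((\<lambda>i. Kern C (f i)) ` I))"
        using direct_summand_cong[OF k(1) L[OF f] eq] fully_invariant_cong[OF k(3) L[OF f] eq] ..
    qed
  next
    assume *: "strongly_baer C TYPE('i) M N"
    then have "baer C TYPE('i) M N"
      unfolding strongly_baer_def baer_def by blast
    then show "K_nonsingular C M N"
      by (rule baer_imp_K_nonsingular[OF ab3 M N])
    show "strongly_cs_baer C TYPE('i) M N"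
      using * L essential_in_refl unfolding strongly_cs_baer_def strongly_baer_def by blast
  qed
qed

lemma dual_cs_baer_iff_dual_baer:
  assumes ab3: "AB3 C TYPE('i)" and M: "M \<in> Obj C" and N: "N \<in> Obj C"
  shows "dual_cs_baer C TYPE('i) M N \<and> T_nonsingular C M N \<longleftrightarrow> dual_baer C TYPE('i) M N"
    and "dual_strongly_cs_baer C TYPE('i) M N \<and> T_nonsingular C M N \<longleftrightarrow>
      dual_strongly_baer C TYPE('i) M N"
proof -
  have L: "subobj C N (SubSum C N ((\<lambda>i. Img C (f i)) ` I))"
    if "\<forall>i \<in> (I :: 'i set). f i \<in> Hom C M N" for I f
    using SubSum_Img(1)[OF ab3 M N] that by blast
  note cong = SubSum_Img_sub_eq[OF ab3 M N]
  show "dual_cs_baer C TYPE('i) M N \<and> T_nonsingular C M N \<longleftrightarrow> dual_baer C TYPE('i) M N"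
  proof (intro iffI conjI)
    assume *: "dual_cs_baer C TYPE('i) M N \<and> T_nonsingular C M N"
    show "dual_baer C TYPE('i) M N"
      unfolding dual_baer_def
    proof (intro allI impI)
      fix I :: "'i set" and f
      assume f: "\<forall>i\<in>I. f i \<in> Hom C M N"
      then obtain k where k: "direct_summand C N k"
        "lies_above C (SubSum C N ((\<lambda>i. Img C (f i)) ` I)) k"
        using * unfolding dual_cs_baer_def by blast
      show "direct_summand C N (SubSum C N ((\<lambda>i. Img C (f i)) ` I))"
        using direct_summand_cong[OF k(1) L[OF f] cong[OF conjunct2[OF *] f k]] .
    qed
  next
    assume *: "dual_baer C TYPE('i) M N"
    then show "T_nonsingular C M N"
      by (rule dual_baer_imp_T_nonsingular[OF ab3 M N])
    show "dual_cs_baer C TYPE('i) M N"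
      using * L lies_above_refl unfolding dual_cs_baer_def dual_baer_def by blast
  qed
  show "dual_strongly_cs_baer C TYPE('i) M N \<and> T_nonsingular C M N \<longleftrightarrow>
      dual_strongly_baer C TYPE('i) M N"
  proof (intro iffI conjI)
    assume *: "dual_strongly_cs_baer C TYPE('i) M N \<and> T_nonsingular C M N"
    show "dual_strongly_baer C TYPE('i) M N"
      unfolding dual_strongly_baer_def
    proof (intro allI impI)
      fix I :: "'i set" and f
      assume f: "\<forall>i\<in>I. f i \<in> Hom C M N"
      then obtain k where k: "direct_summand C N k"
        "lies_above C (SubSum C N ((\<lambda>i. Img C (f i)) ` I)) k" "fully_invariant C N k"
        using * unfolding dual_strongly_cs_baer_def by blast
      note eq = cong[OF conjunct2[OF *] f k(1,2)]
      show "direct_summand C N (SubSum C N ((\<lambda>i. Img C (f i)) ` I)) \<and>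
          fully_invariant C N (SubSum C N ((\<lambda>i. Img C (f i)) ` I))"
        using direct_summand_cong[OF k(1) L[OF f] eq] fully_invariant_cong[OF k(3) L[OF f] eq] ..
    qed
  next
    assume *: "dual_strongly_baer C TYPE('i) M N"
    then have "dual_baer C TYPE('i) M N"
      unfolding dual_strongly_baer_def dual_baer_def by blast
    then show "T_nonsingular C M N"
      by (rule dual_baer_imp_T_nonsingular[OF ab3 M N])
    show "dual_strongly_cs_baer C TYPE('i) M N"
      using * L lies_above_refl unfolding dual_strongly_cs_baer_def dual_strongly_baer_def by blast
  qed
qed

end

theorem theorem4p3:
  fixes C :: "('o, 'm) abcat" and M N :: 'o
  assumes "abelian_category C" and "M \<in> Obj C" and "N \<in> Obj C"
  shows "(AB3_star C TYPE('i) \<longrightarrow>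
      ((cs_baer C TYPE('i) M N \<and> K_nonsingular C M N) \<longleftrightarrow> baer C TYPE('i) M N) \<and>
      ((strongly_cs_baer C TYPE('i) M N \<and> K_nonsingular C M N) \<longleftrightarrow>
        strongly_baer C TYPE('i) M N)) \<and>
    (AB3 C TYPE('i) \<longrightarrow>
      ((dual_cs_baer C TYPE('i) M N \<and> T_nonsingular C M N) \<longleftrightarrow>
        dual_baer C TYPE('i) M N) \<and>
      ((dual_strongly_cs_baer C TYPE('i) M N \<and> T_nonsingular C M N) \<longleftrightarrow>
        dual_strongly_baer C TYPE('i) M N))"
  using abelian_category.cs_baer_iff_baer[OF assms(1) _ assms(2,3)]
    abelian_category.dual_cs_baer_iff_dual_baer[OF assms(1) _ assms(2,3)]
  by (intro conjI impI)

end
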